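(* Let $X$ be a nonnegative random variable satisfying the Cramér condition, with moment-generating function $M_X$. Let $\mathcal{X}$ be a compact Hausdorff space with a Borel measure $\mu$, let $\alpha:\mathcal{X}\to\mathcal{X}$ be a continuous map preserving $\mu$, let $1\le p<\infty$, and for $\varphi\in C(\mathcal{X})$ let $\lambda(\varphi)=\ln r(e^{\varphi}C_\alpha)$, where $r(e^{\varphi}C_\alpha)$ is the spectral radius of the weighted composition operator $e^\varphi C_\alpha$ on $L^p(\mathcal{X},\mu)$. Let $\tau_\alpha$ be the $\mathbf{t}$-entropy. Define $\widetilde{\lambda}_X: C(\mathcal{X})\to(-\infty,+\infty]$ by $$\widetilde{\lambda}_X(\varphi)=\begin{cases}(\ln M_X\circ\exp)(\lambda(\varphi)) & \text{if } \varphi\in\lambda^{-1}(\mathcal{D}(\ln M_X\circ\exp)),\\ +\infty & \text{otherwise,}\end{cases}$$ and put $$\widetilde{\mathcal{M}}=\{\widetilde{\nu}=a\nu:\ \nu\in\mathcal{M}^1_\alpha \text{ and } a\in\mathcal{D}((\ln M_X\circ\exp)^{\ast})\}.$$ Then the effective domain of the convex conjugate $\widetilde{\lambda}_X^{\ast}$ (a functional on $C(\mathcal{X})^\ast$) is contained in $\widetilde{\mathcal{M}}$; for $\widetilde{\nu}\in\widetilde{\mathcal{M}}$ with $\widetilde{\nu}(\mathcal{X})>0$, $$\widetilde{\lambda}_X^{\ast}(\widetilde{\nu})=\frac{1}{p}\,\widetilde{\nu}(\mathcal{X})\,\tau_\alpha\Big(\frac{\widetilde{\nu}}{\widetilde{\nu}(\mathcal{X})}\Big)+(\ln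 M_X\circ\exp)^{\ast}(\widetilde{\nu}(\mathcal{X}));$$ and if $\widetilde{\nu}(\mathcal{X})=0$ (that is, $\widetilde{\nu}=\mathbf{0}$), then $\widetilde{\lambda}_X^{\ast}(\mathbf{0})=0$.
   Context: Random variables: $M_X(t)=E e^{tX}\in(0,+\infty]$ for $t\in\mathbb{R}$, and $\ln(+\infty)=+\infty$. $X$ satisfies the Cramér condition if there is $c>0$ with $E e^{c|X|}<\infty$. Convex conjugates: for a functional $f$ on a real locally convex Hausdorff space $L$ with values in $[-\infty,+\infty]$, the effective domain is $\mathcal{D}(f)=\{\varphi\in L: f(\varphi)<+\infty\}$ and the convex conjugate (Legendre-Fenchel transform) is $f^{\ast}(\mu)=\sup_{\varphi\in L}\{\langle\mu,\varphi\rangle-f(\varphi)\}$ for $\mu\in L^{\ast}$. For $L=\mathbb{R}$, $f^\ast(a)=\sup_{t\in\mathbb{R}}\{at-f(t)\}$. Here $(\ln M_X\circ\exp)(t)=\ln M_X(e^t)$, $t\in\mathbb{R}$. Weighted composition operators: $C(\mathcal{X})$ is the space of real continuous functions on $\mathcal{X}$ with the sup norm; its dual is identified with finite signed (regular) Borel measures. "$\alpha$ preserves $\mu$" means $\mu\circ\alpha^{-1}=\mu$. For $g\in C(\mathcal{X})$, $(gC_\alpha)u(x)=g(x)u(\alpha(x))$, acting on $L^p(\mathcal{X},\mu)$. $\mathcal{M}^1_\alpha$ is the set of $\alpha$-invariant Borel probability measures on $\mathcal{X}$. $\mathbf{t}$-entropy: $\tau_\alpha:\mathcal{M}^1_\alpha\to[0,+\infty]$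 is the convex, lower semicontinuous (weak-$\ast$) functional (depending on $\mu$ and $\alpha$, not on $p$) constructed by Antonevich, Bakhtin and Lebedev, for which the following known variational principle holds for all $1\le p<\infty$ and $g\in C(\mathcal{X})$: $$\ln r(gC_\alpha)=\max_{\nu\in\mathcal{M}^1_\alpha}\Big\{\int_{\mathcal{X}}\ln|g|\,d\nu-\frac{\tau_\alpha(\nu)}{p}\Big\}.$$ Equivalently, the functional $\lambda$ is convex and continuous on $C(\mathcal{X})$, its convex conjugate satisfies $\lambda^{\ast}(\nu)=\tau_\alpha(\nu)/p$ for $\nu\in\mathcal{M}^1_\alpha$, and $\lambda^{\ast}=+\infty$ off $\mathcal{M}^1_\alpha$; this determines $\tau_\alpha$ uniquely, via $\tau_\alpha(\nu)=p\sup_{\varphi\in C(\mathcal{X})}\{\int_{\mathcal{X}}\varphi\,d\nu-\lambda(\varphi)\}$. *)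

theory Defs
  imports "HOL-Probability.Probability"
begin

section \<open>Convex conjugates\<close>

text \<open>
  The second argument is an element of the dual space, given as a function on the space.
  In \<^typ>\<open>ereal\<close>, \<^prop>\<open>ereal r - \<infinity> = -\<infinity>\<close>, as the supremum requires.
\<close>

definition conjugate :: "('v \<Rightarrow> ereal) \<Rightarrow> ('v \<Rightarrow> real) \<Rightarrow> ereal" where
  "conjugate f \<mu> = (SUP \<phi>. ereal (\<mu> \<phi>) - f \<phi>)"

definition conjugate_real :: "(real \<Rightarrow> ereal) \<Rightarrow> real \<Rightarrow> ereal" where
  "conjugate_real f a = conjugate f (\<lambda>t. a * t)"

definition conjugate_dual ::
  "('v::real_normed_vector \<Rightarrow> ereal) \<Rightarrow> ('v \<Rightarrow>\<^sub>L real) \<Rightarrow> ereal" where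
  "conjugate_dual f \<Lambda> = conjugate f (blinfun_apply \<Lambda>)"

definition eff_domain :: "('v \<Rightarrow> ereal) \<Rightarrow> 'v set" where
  "eff_domain f = {\<phi>. f \<phi> < \<infinity>}"


section \<open>Moment-generating functions\<close>

definition ext_ln :: "ennreal \<Rightarrow> ereal" where
  "ext_ln y = (if y = 0 then -\<infinity> else if y = \<infinity> then \<infinity> else ereal (ln (enn2real y)))"

definition mgf :: "'w measure \<Rightarrow> ('w \<Rightarrow> real) \<Rightarrow> real \<Rightarrow> ennreal" where
  "mgf P X t = (\<integral>\<^sup>+ w. ennreal (exp (t * X w)) \<partial>P)"

definition cramer_condition :: "'w measure \<Rightarrow> ('w \<Rightarrow> real) \<Rightarrow> bool" where
  "cramer_condition P X \<longleftrightarrow> (\<exists>c>0. (\<integral>\<^sup>+ w. ennreal (exp (c * \<bar>X w\<bar>)) \<partial>P) < \<infinity>)"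

definition ln_mgf_exp :: "'w measure \<Rightarrow> ('w \<Rightarrow> real) \<Rightarrow> real \<Rightarrow> ereal" where
  "ln_mgf_exp P X t = ext_ln (mgf P X (exp t))"


section \<open>Operators on complex \<open>L\<^sup>p\<close> and their spectral radius\<close>

text \<open>
  Elements of \<open>L\<^sup>p(\<mu>)\<close> are handled through representatives; all identities between them
  hold almost everywhere. Scalars are complex, as the spectrum requires.
\<close>

definition Lp_space :: "'a measure \<Rightarrow> real \<Rightarrow> ('a \<Rightarrow> complex) set" where
  "Lp_space \<mu> p =
     {u \<in> borel_measurable \<mu>. integrable \<mu> (\<lambda>x. cmod (u x) powr p)}"

definition Lp_norm :: "'a measure \<Rightarrow> real \<Rightarrow> ('a \<Rightarrow> complex) \<Rightarrow> real" where
  "Lp_norm \<mu> p u = (\<integral>x. cmod (u x) powr p \<partial>\<mu>) powr (1 / p)"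

text \<open>
  Compatibility with almost-everywhere equality follows from linearity and boundedness.
\<close>

definition Lp_operator ::
  "'a measure \<Rightarrow> real \<Rightarrow> (('a \<Rightarrow> complex) \<Rightarrow> ('a \<Rightarrow> complex)) \<Rightarrow> bool" where
  "Lp_operator \<mu> p S \<longleftrightarrow>
     (\<forall>u\<in>Lp_space \<mu> p. S u \<in> Lp_space \<mu> p) \<and>
     (\<forall>u\<in>Lp_space \<mu> p. \<forall>v\<in>Lp_space \<mu> p.
        AE x in \<mu>. S (\<lambda>y. u y + v y) x = S u x + S v x) \<and>
     (\<forall>c. \<forall>u\<in>Lp_space \<mu> p. AE x in \<mu>. S (\<lambda>y. c * u y) x = c * S u x) \<and>
     (\<exists>K. \<forall>u\<in>Lp_space \<mu> p. Lp_norm \<mu> p (S u) \<le> K * Lp_norm \<mu> p u)"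

definition Lp_spectrum ::
  "'a measure \<Rightarrow> real \<Rightarrow> (('a \<Rightarrow> complex) \<Rightarrow> ('a \<Rightarrow> complex)) \<Rightarrow> complex set" where
  "Lp_spectrum \<mu> p T =
     {z. \<not> (\<exists>R. Lp_operator \<mu> p R \<and>
          (\<forall>u\<in>Lp_space \<mu> p.
             (AE x in \<mu>. R (\<lambda>y. z * u y - T u y) x = u x) \<and>
             (AE x in \<mu>. z * R u x - T (R u) x = u x)))}"

definition Lp_spectral_radius ::
  "'a measure \<Rightarrow> real \<Rightarrow> (('a \<Rightarrow> complex) \<Rightarrow> ('a \<Rightarrow> complex)) \<Rightarrow> real" where
  "Lp_spectral_radius \<mu> p T = (SUP z\<in>Lp_spectrum \<mu> p T. cmod z)"

definition weighted_composition ::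
  "('a \<Rightarrow> real) \<Rightarrow> ('a \<Rightarrow> 'a) \<Rightarrow> ('a \<Rightarrow> complex) \<Rightarrow> ('a \<Rightarrow> complex)" where
  "weighted_composition g \<alpha> u = (\<lambda>x. complex_of_real (g x) * u (\<alpha> x))"

text \<open>
  On a compact space, \<^typ>\<open>'a \<Rightarrow>\<^sub>C real\<close> is the space of all continuous functions with the
  sup norm.
\<close>

definition spectral_exponent ::
  "'a::topological_space measure \<Rightarrow> ('a \<Rightarrow> 'a) \<Rightarrow> real \<Rightarrow> ('a \<Rightarrow>\<^sub>C real) \<Rightarrow> real" where
  "spectral_exponent \<mu> \<alpha> p \<phi> =
     ln (Lp_spectral_radius \<mu> p
           (weighted_composition (\<lambda>x. exp (apply_bcontfun \<phi> x)) \<alpha>))"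


section \<open>Measures as functionals on the continuous functions\<close>

definition functional_of :: "'a::topological_space measure \<Rightarrow> ('a \<Rightarrow>\<^sub>C real) \<Rightarrow>\<^sub>L real" where
  "functional_of \<nu> = Blinfun (\<lambda>\<phi>. \<integral>x. apply_bcontfun \<phi> x \<partial>\<nu>)"

lemma functional_of_apply:
  assumes "finite_measure \<nu>" "sets \<nu> = sets borel"
  shows "blinfun_apply (functional_of \<nu>) \<phi> = (\<integral>x. apply_bcontfun \<phi> x \<partial>\<nu>)"
proof -
  interpret finite_measure \<nu> by fact
  have meas: "apply_bcontfun f \<in> borel_measurable \<nu>" for f :: "'a \<Rightarrow>\<^sub>C real"
  proof -
    have "apply_bcontfun f \<in> borel_measurable borel"
      by (intro borel_measurable_continuous_onI continuous_on_apply_bcontfun)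
    then show ?thesis by (simp cong: measurable_cong_sets add: assms(2))
  qed
  have int: "integrable \<nu> (apply_bcontfun f)" for f :: "'a \<Rightarrow>\<^sub>C real"
    by (rule integrable_const_bound[where B = "norm f"]) (use norm_bounded[of f] in \<open>auto simp: meas\<close>)
  have "bounded_linear (\<lambda>f :: 'a \<Rightarrow>\<^sub>C real. \<integral>x. apply_bcontfun f x \<partial>\<nu>)"
  proof (rule bounded_linear_intro[where K = "measure \<nu> (space \<nu>)"])
    fix f :: "'a \<Rightarrow>\<^sub>C real"
    have "norm (\<integral>x. apply_bcontfun f x \<partial>\<nu>) \<le> (\<integral>x. norm (apply_bcontfun f x) \<partial>\<nu>)"
      by (rule integral_norm_bound)
    also have "\<dots> \<le> (\<integral>x. norm f \<partial>\<nu>)"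
      by (rule integral_mono) (use norm_bounded[of f] int[of f] in auto)
    finally show "norm (\<integral>x. apply_bcontfun f x \<partial>\<nu>) \<le> norm f * measure \<nu> (space \<nu>)"
      by (simp add: mult.commute)
  qed (auto simp: int)
  then show ?thesis
    unfolding functional_of_def by (simp add: bounded_linear_Blinfun_apply)
qed

text \<open>\<open>\<nu>(\<X>) = \<integral>1 d\<nu>\<close> for the measure \<open>\<nu>\<close> represented by the functional.\<close>

definition total_mass :: "(('a::topological_space \<Rightarrow>\<^sub>C real) \<Rightarrow>\<^sub>L real) \<Rightarrow> real" where
  "total_mass \<Lambda> = blinfun_apply \<Lambda> (const_bcontfun 1)"

definition regular_borel :: "'a::topological_space measure \<Rightarrow> bool" where
  "regular_borel \<nu> \<longleftrightarrow> sets \<nu> = sets borel \<and>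
     (\<forall>A\<in>sets borel.
        emeasure \<nu> A = (SUP K\<in>{K. compact K \<and> K \<subseteq> A}. emeasure \<nu> K) \<and>
        emeasure \<nu> A = (INF U\<in>{U. open U \<and> A \<subseteq> U}. emeasure \<nu> U))"

text \<open>
  Regularity makes \<^const>\<open>functional_of\<close> injective on these measures when the
  underlying space is compact Hausdorff.
\<close>

definition invariant_probs :: "('a::topological_space \<Rightarrow> 'a) \<Rightarrow> 'a measure set" where
  "invariant_probs \<alpha> =
     {\<nu>. prob_space \<nu> \<and> regular_borel \<nu> \<and> distr \<nu> borel \<alpha> = \<nu>}"

text \<open>
  The \<open>\<^bold>t\<close>-entropy depends on \<open>\<mu>\<close> and \<open>\<alpha>\<close> only. The variational principle, with
  \<open>\<lambda>\<^sub>p(\<phi>) = ln r(e\<^sup>\<phi> C\<^sub>\<alpha>)\<close> on \<open>L\<^sup>p(\<mu>)\<close>, determines it for any single exponent \<open>p\<close> as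
  \<open>\<tau>\<^sub>\<alpha>(\<nu>) = p sup {\<integral>\<phi> d\<nu> - \<lambda>\<^sub>p(\<phi>)}\<close>; here it is read off from \<open>p = 1\<close>.
  Only its values at the functionals of invariant probability measures matter.
\<close>

definition t_entropy ::
  "'a::topological_space measure \<Rightarrow> ('a \<Rightarrow> 'a) \<Rightarrow> (('a \<Rightarrow>\<^sub>C real) \<Rightarrow>\<^sub>L real) \<Rightarrow> ereal" where
  "t_entropy \<mu> \<alpha> \<Lambda> = conjugate_dual (\<lambda>\<phi>. ereal (spectral_exponent \<mu> \<alpha> 1 \<phi>)) \<Lambda>"


section \<open>The transformed functional\<close>

definition lambda_X ::
  "'w measure \<Rightarrow> ('w \<Rightarrow> real) \<Rightarrow> 'a::topological_space measure \<Rightarrow> ('a \<Rightarrow> 'a) \<Rightarrow> real \<Rightarrow>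
     ('a \<Rightarrow>\<^sub>C real) \<Rightarrow> ereal" where
  "lambda_X P X \<mu> \<alpha> p \<phi> =
     (if spectral_exponent \<mu> \<alpha> p \<phi> \<in> eff_domain (ln_mgf_exp P X)
      then ln_mgf_exp P X (spectral_exponent \<mu> \<alpha> p \<phi>) else \<infinity>)"

definition M_tilde ::
  "'w measure \<Rightarrow> ('w \<Rightarrow> real) \<Rightarrow> ('a::topological_space \<Rightarrow> 'a) \<Rightarrow>
     (('a \<Rightarrow>\<^sub>C real) \<Rightarrow>\<^sub>L real) set" where
  "M_tilde P X \<alpha> =
     {a *\<^sub>R functional_of \<nu> | a \<nu>.
        \<nu> \<in> invariant_probs \<alpha> \<and> a \<in> eff_domain (conjugate_real (ln_mgf_exp P X))}"

end

theory Submission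
  imports Defs
begin

text \<open>
  Write \<open>F = ln M\<^sub>X \<circ> exp\<close> and let \<open>\<lambda>\<close> be the spectral exponent on \<open>L\<^sup>p(\<mu>)\<close>.  Multiplying an operator by
  \<open>e\<^sup>c\<close> multiplies its spectral radius by \<open>e\<^sup>c\<close>, so \<open>\<lambda>(\<phi> + c) = \<lambda>(\<phi>) + c\<close>.  In the supremum that defines
  the conjugate of \<open>F \<circ> \<lambda>\<close> one may therefore write every \<open>\<phi>\<close> as \<open>\<psi> + (s - \<lambda>(\<psi>))\<close>, where \<open>s = \<lambda>(\<phi>)\<close>
  and \<open>\<psi>\<close> vary independently.  For a functional \<open>\<Lambda>\<close> of total mass \<open>a = \<Lambda>(1)\<close> the supremum splits into

      \<open>sup\<^sub>\<psi> (\<Lambda>(\<psi>) - a \<lambda>(\<psi>)) + F\<^sup>*(a)\<close>.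

  For \<open>a > 0\<close> the first term is \<open>a\<close> times the conjugate of \<open>\<lambda>\<close> at \<open>\<Lambda>/a\<close>, which is the \<open>\<^bold>t\<close>-entropy
  divided by \<open>p\<close>; this gives the formula.  For \<open>a = 0\<close> it is \<open>0\<close> or \<open>\<infinity>\<close> according to whether \<open>\<Lambda> = 0\<close> or not,
  and \<open>F\<^sup>*(0) = - inf F = 0\<close> since \<open>F \<ge> 0\<close> and \<open>M\<^sub>X(t)\<close> tends to \<open>1\<close> as \<open>t\<close> decreases to \<open>0\<close>.  For
  \<open>a < 0\<close> the second term is \<open>\<infinity>\<close>, because \<open>F\<close> is bounded near \<open>-\<infinity>\<close>.

  The properties of \<open>\<lambda>\<close> come from a description of the spectral radius without operators.  Since
  \<open>|(e\<^sup>\<phi> C\<^sub>\<alpha>)\<^sup>n u|\<^sup>p = e\<^bsup>p S\<^sub>n\<phi>\<^esup> |u|\<^sup>p \<circ> \<alpha>\<^sup>n\<close> with the Birkhoff sums \<open>S\<^sub>n\<phi>\<close>, the norms of the powers on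
  \<open>L\<^sup>p\<close> are governed by the growth of \<open>w \<mapsto> \<integral> e\<^bsup>p S\<^sub>n\<phi>\<^esup> w \<circ> \<alpha>\<^sup>n d\<mu>\<close> on nonnegative functions \<open>w\<close>.  If \<open>G(\<psi>)\<close>
  denotes the exponential rate for \<open>\<psi> = p \<phi>\<close>, then \<open>\<lambda>(\<phi>) = G(p \<phi>) / p\<close> (lemma \<open>spectral_radius\<close>).  One half is
  the Neumann series.  The other half, that the rate is attained on the spectrum, uses positivity:
  if \<open>e\<^bsup>G/p\<^esup>\<close> were a regular value, the partial sums of the Neumann series would be bounded at that point,
  and squaring them would make the powers decay faster than \<open>G\<close> permits.
  Translation equivariance, monotonicity, the invariance under coboundaries \<open>f \<circ> \<alpha> - f\<close> and the
  relation between different exponents \<open>p\<close> can then be read off from the Birkhoff sums.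

  Finally, suppose \<open>a > 0\<close> and \<open>sup\<^sub>\<psi> (\<Lambda>(\<psi>) - a \<lambda>(\<psi>))\<close> is finite.  As \<open>\<lambda> \<le> 0\<close> on the rays spanned by nonpositive
  functions and by coboundaries, \<open>\<Lambda>\<close> must be \<open>\<le> 0\<close> on them, so \<open>\<Lambda>/a\<close> is positive, normalized and
  invariant.  The Riesz representation theorem, proved below for compact Hausdorff spaces, turns it into an
  invariant regular probability measure.  The same theorem, applied to a cluster point of Birkhoff averages,
  provides an invariant measure at all, which is what places \<open>0\<close> in the set \<open>M_tilde\<close>.
\<close>

section \<open>Riesz representation on a compact Hausdorff space\<close>

locale normalized_positive_functional =
  fixes L :: "('a::t2_space \<Rightarrow> real) \<Rightarrow> real"
  assumes compact_space: "compact (UNIV :: 'a set)"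
    and add: "\<And>f g. continuous_on UNIV f \<Longrightarrow> continuous_on UNIV g \<Longrightarrow> L (\<lambda>x. f x + g x) = L f + L g"
    and scale: "\<And>f c. continuous_on UNIV f \<Longrightarrow> L (\<lambda>x. c * f x) = c * L f"
    and nonneg: "\<And>f. continuous_on UNIV f \<Longrightarrow> (\<And>x. 0 \<le> f x) \<Longrightarrow> 0 \<le> L f"
    and one: "L (\<lambda>_. 1) = 1"
begin

lemma const: "L (\<lambda>_. c) = c"
  using scale[of "\<lambda>_. 1" c] one by simp

lemma mono:
  assumes "continuous_on UNIV f" "continuous_on UNIV g" "\<And>x. f x \<le> g x"
  shows "L f \<le> L g"
proof -
  have "L (\<lambda>x. f x + (g x - f x)) = L f + L (\<lambda>x. g x - f x)"
    by (rule add) (intro continuous_intros assms)+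
  moreover have "0 \<le> L (\<lambda>x. g x - f x)"
    using assms(3) by (intro nonneg continuous_intros assms) simp
  ultimately show ?thesis by simp
qed

lemma urysohn:
  assumes "closed S" "closed T" "S \<inter> T = {}"
  obtains h :: "'a \<Rightarrow> real" where "continuous_on UNIV h" "\<And>x. 0 \<le> h x" "\<And>x. h x \<le> 1"
    "\<And>x. x \<in> S \<Longrightarrow> h x = 0" "\<And>x. x \<in> T \<Longrightarrow> h x = 1"
proof -
  have "Hausdorff_space (euclidean :: 'a topology)"
    unfolding Hausdorff_space_def
    by (auto simp: disjnt_def) (metis hausdorff)
  moreover have "compact_space (euclidean :: 'a topology)"
    using compact_space by (simp add: compact_space_def)
  ultimately have "normal_space (euclidean :: 'a topology)"
    using compact_Hausdorff_or_regular_imp_normal_space by blast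
  then obtain h where h: "continuous_map euclidean (top_of_set {0..1::real}) h"
      "h ` S \<subseteq> {0}" "h ` T \<subseteq> {1}"
    using Urysohn_lemma[of euclidean S T 0 1] assms by (auto simp: disjnt_def)
  show thesis
    by (rule that[of h]) (use h in \<open>auto simp: continuous_map_in_subtopology\<close>)
qed

text \<open>
  The representing measure of an open set is the supremum of \<open>L\<close> over the continuous functions between \<open>0\<close>
  and its indicator.  These functions need not have their support inside the open set; truncation
  (\<open>cut_below\<close>) supplies the room that a support condition would give.
\<close>

definition below :: "'a set \<Rightarrow> ('a \<Rightarrow> real) set" where
  "below U = {f. continuous_on UNIV f \<and> (\<forall>x. 0 \<le> f x \<and> f x \<le> 1) \<and> (\<forall>x. x \<notin> U \<longrightarrow> f x = 0)}"

definition content :: "'a set \<Rightarrow> ennreal" where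
  "content U = (SUP f\<in>below U. ennreal (L f))"

definition outer :: "'a set \<Rightarrow> ennreal" where
  "outer A = (INF U\<in>{U. open U \<and> A \<subseteq> U}. content U)"

lemma belowI:
  "continuous_on UNIV f \<Longrightarrow> (\<And>x. 0 \<le> f x) \<Longrightarrow> (\<And>x. f x \<le> 1) \<Longrightarrow>
    (\<And>x. x \<notin> U \<Longrightarrow> f x = 0) \<Longrightarrow> f \<in> below U"
  by (auto simp: below_def)

lemma belowD:
  assumes "f \<in> below U"
  shows "continuous_on UNIV f" "0 \<le> f x" "f x \<le> 1" "x \<notin> U \<Longrightarrow> f x = 0"
  using assms by (auto simp: below_def)

lemma zero_below: "(\<lambda>_. 0) \<in> below U"
  by (auto simp: below_def)

lemma below_ne: "below U \<noteq> {}"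
  using zero_below by auto

lemma content_ge: "f \<in> below U \<Longrightarrow> ennreal (L f) \<le> content U"
  unfolding content_def by (rule SUP_upper)

lemma content_mono: "U \<subseteq> V \<Longrightarrow> content U \<le> content V"
  unfolding content_def by (rule SUP_subset_mono) (auto simp: below_def)

lemma below_nonneg: "f \<in> below U \<Longrightarrow> 0 \<le> L f"
  by (rule nonneg) (auto simp: below_def)

lemma content_empty: "content {} = 0"
proof -
  have "L f = 0" if "f \<in> below {}" for f
  proof -
    have "f = (\<lambda>_. 0)" using that by (auto simp: below_def)
    then show ?thesis by (simp add: const)
  qed
  then show ?thesis using below_ne unfolding content_def by (auto intro!: antisym SUP_least)
qed

lemma content_UNIV: "content UNIV = 1"
proof (rule antisym)
  show "content UNIV \<le> 1" unfolding content_def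
  proof (rule SUP_least)
    fix f assume "f \<in> below UNIV"
    then have "L f \<le> L (\<lambda>_. 1)" by (intro mono) (auto simp: below_def)
    then show "ennreal (L f) \<le> 1" by (simp add: one)
  qed
  show "1 \<le> content UNIV"
    using content_ge[of "\<lambda>_. 1" UNIV] by (simp add: below_def one)
qed

text \<open>
  Lowering a function by \<open>e\<close> costs at most \<open>e\<close> and makes it vanish on the closed set
  \<open>{f \<le> e}\<close>. This replaces the compact supports of the usual construction.
\<close>

lemma cut_below:
  assumes "f \<in> below U" "0 \<le> e"
  shows "(\<lambda>x. max 0 (f x - e)) \<in> below (U \<inter> {x. e < f x})"
    and "L f \<le> L (\<lambda>x. max 0 (f x - e)) + e"
proof -
  have cont: "continuous_on UNIV (\<lambda>x. max 0 (f x - e))"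
    by (intro continuous_intros belowD(1)[OF assms(1)])
  show "(\<lambda>x. max 0 (f x - e)) \<in> below (U \<inter> {x. e < f x})"
  proof (rule belowI[OF cont])
    fix x
    show "max 0 (f x - e) \<le> 1" using belowD(3)[OF assms(1), of x] assms(2) by simp
    show "max 0 (f x - e) = 0" if "x \<notin> U \<inter> {x. e < f x}"
      using that belowD(4)[OF assms(1), of x] assms(2) by (cases "x \<in> U") auto
  qed simp
  have "L f \<le> L (\<lambda>x. max 0 (f x - e) + e)"
    by (intro mono continuous_intros belowD(1)[OF assms(1)]) simp
  also have "\<dots> = L (\<lambda>x. max 0 (f x - e)) + e"
    using add[OF cont, of "\<lambda>_. e"] by (simp add: const)
  finally show "L f \<le> L (\<lambda>x. max 0 (f x - e)) + e" .
qed

text \<open>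
  A function below \<open>U \<union> V\<close> is, after truncation at height \<open>e\<close>, a sum of one below \<open>U\<close> and one below \<open>V\<close>:
  the closed set \<open>{f \<ge> e} - V\<close> lies in \<open>U\<close>, and the Urysohn function \<open>h\<close> that separates it from the complement of
  \<open>U\<close> splits \<open>f' = f' h + f' (1 - h)\<close>.
\<close>

lemma content_Un:
  assumes "open U" "open V"
  shows "content (U \<union> V) \<le> content U + content V"
  unfolding content_def[of "U \<union> V"]
proof (rule SUP_least, rule ennreal_le_epsilon)
  fix f and e :: real assume f: "f \<in> below (U \<union> V)" and e: "0 < e"
  have cf: "continuous_on UNIV f" using f by (auto simp: below_def)
  define f' where "f' = (\<lambda>x. max 0 (f x - e))"
  have f': "f' \<in> below ((U \<union> V) \<inter> {x. e < f x})" "L f \<le> L f' + e"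
    unfolding f'_def by (rule cut_below[OF f less_imp_le[OF e]])+
  have cf': "continuous_on UNIV f'" using f' by (auto simp: below_def)
  have "closed {x. e \<le> f x}" by (intro closed_Collect_le cf continuous_intros)
  then have "closed ({x. e \<le> f x} - V)" using \<open>open V\<close> by (rule closed_Diff)
  moreover have "closed (- U)" using \<open>open U\<close> by (rule closed_Compl)
  moreover have "(- U) \<inter> ({x. e \<le> f x} - V) = {}" using f e by (force simp: below_def)
  ultimately obtain h where h: "continuous_on UNIV h" "\<And>x. 0 \<le> h x" "\<And>x. h x \<le> (1::real)"
      "\<And>x. x \<in> - U \<Longrightarrow> h x = 0" "\<And>x. x \<in> {x. e \<le> f x} - V \<Longrightarrow> h x = 1"
    using urysohn by metis
  have range: "0 \<le> f' x" "f' x \<le> 1" for x using f' by (auto simp: below_def)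
  have 1: "(\<lambda>x. f' x * h x) \<in> below U"
    using h range cf' by (intro belowI continuous_intros) (auto intro: mult_le_one)
  have 3: "f' x = 0 \<or> h x = 1" if "x \<notin> V" for x
    using that h(5)[of x] by (cases "e \<le> f x") (auto simp: f'_def)
  have 2: "(\<lambda>x. f' x * (1 - h x)) \<in> below V"
    using h range cf' 3 by (intro belowI continuous_intros) (auto intro: mult_le_one)
  have "L f' = L (\<lambda>x. f' x * h x) + L (\<lambda>x. f' x * (1 - h x))"
    using add[of "\<lambda>x. f' x * h x" "\<lambda>x. f' x * (1 - h x)"] 1 2
    by (simp add: below_def algebra_simps)
  then have "ennreal (L f') \<le> content U + content V"
    using content_ge[OF 1] content_ge[OF 2] below_nonneg[OF 1] below_nonneg[OF 2]
    by (simp add: add_mono)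
  then show "ennreal (L f) \<le> content U + content V + ennreal e"
    using f'(2) below_nonneg[OF f'(1)] e
    by (metis add_right_mono ennreal_leI ennreal_plus less_eq_real_def order_trans)
qed

lemma content_UN_finite:
  assumes "finite I" "\<And>i. i \<in> I \<Longrightarrow> open (U i)"
  shows "content (\<Union>i\<in>I. U i) \<le> (\<Sum>i\<in>I. content (U i))"
  using assms
proof (induction I rule: finite_induct)
  case (insert i I)
  have "content (\<Union>i\<in>insert i I. U i) \<le> content (U i) + content (\<Union>i\<in>I. U i)"
    using content_Un[of "U i" "\<Union>i\<in>I. U i"] insert by auto
  then show ?case using insert by (auto intro: order_trans add_left_mono)
qed (simp add: content_empty)

text \<open>
  Compactness of \<open>{f \<ge> e}\<close> reduces a countable cover to a finite one.
\<close>

lemma content_UN: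
  assumes "\<And>i::nat. open (U i)"
  shows "content (\<Union>i. U i) \<le> (\<Sum>i. content (U i))"
  unfolding content_def[of "\<Union>i. U i"]
proof (rule SUP_least, rule ennreal_le_epsilon)
  fix f and e :: real assume f: "f \<in> below (\<Union>i. U i)" and e: "0 < e"
  have cf: "continuous_on UNIV f" using f by (auto simp: below_def)
  define f' where "f' = (\<lambda>x. max 0 (f x - e))"
  have f': "f' \<in> below ((\<Union>i. U i) \<inter> {x. e < f x})" "L f \<le> L f' + e"
    unfolding f'_def by (rule cut_below[OF f less_imp_le[OF e]])+
  have "closed {x. e \<le> f x}" by (intro closed_Collect_le cf continuous_intros)
  then have "compact {x. e \<le> f x}"
    using compact_Int_closed[OF compact_space] by simp
  moreover have "{x. e \<le> f x} \<subseteq> (\<Union>i\<in>UNIV. U i)" using f e by (force simp: below_def)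
  ultimately obtain I where I: "finite I" "{x. e \<le> f x} \<subseteq> (\<Union>i\<in>I. U i)"
    using compactE_image[of "{x. e \<le> f x}" UNIV U] assms by metis
  have "f' \<in> below (\<Union>i\<in>I. U i)"
    using f'(1) I(2) by (force simp: below_def)
  then have "ennreal (L f') \<le> (\<Sum>i\<in>I. content (U i))"
    using content_UN_finite[OF I(1), of U] content_ge assms by (meson order_trans)
  also have "\<dots> \<le> (\<Sum>i. content (U i))"
    by (rule sum_le_suminf) (auto simp: I)
  finally show "ennreal (L f) \<le> (\<Sum>i. content (U i)) + ennreal e"
    using f'(2) below_nonneg[OF f'(1)] e
    by (metis add_right_mono ennreal_leI ennreal_plus less_eq_real_def order_trans)
qed

lemma outer_open: "open U \<Longrightarrow> outer U = content U"
  unfolding outer_def by (rule antisym) (auto intro: INF_lower INF_greatest content_mono)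

lemma outer_le: "open U \<Longrightarrow> A \<subseteq> U \<Longrightarrow> outer A \<le> content U"
  unfolding outer_def by (rule INF_lower) simp

lemma outer_mono: "A \<subseteq> B \<Longrightarrow> outer A \<le> outer B"
  unfolding outer_def by (rule INF_superset_mono) auto

lemma outer_finite: "outer A < top"
  using outer_le[of UNIV A] by (simp add: content_UNIV order_le_less_trans)

lemma outer_approx:
  assumes "0 < e"
  obtains U where "open U" "A \<subseteq> U" "content U \<le> outer A + ennreal e"
proof -
  have "outer A < outer A + ennreal e"
    using outer_finite[of A] assms by (cases "outer A" rule: ennreal_cases) (auto simp flip: ennreal_plus simp: ennreal_less_iff)
  then obtain U where "open U" "A \<subseteq> U" "content U < outer A + ennreal e"
    unfolding outer_def[of A] INF_less_iff by auto
  then show thesis using that by (meson less_imp_le)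
qed

lemma outer_UN: "outer (\<Union>i::nat. A i) \<le> (\<Sum>i. outer (A i))"
proof (rule ennreal_le_epsilon)
  fix e :: real assume e: "0 < e"
  have "\<exists>U. open U \<and> A i \<subseteq> U \<and> content U \<le> outer (A i) + ennreal (e * (1/2)^Suc i)" for i
    using outer_approx[of "e * (1/2)^Suc i" "A i"] e by (metis divide_pos_pos mult_pos_pos zero_less_numeral zero_less_one zero_less_power)
  then obtain U where U: "\<And>i. open (U i)" "\<And>i. A i \<subseteq> U i"
      "\<And>i. content (U i) \<le> outer (A i) + ennreal (e * (1/2)^Suc i)" by metis
  have "outer (\<Union>i. A i) \<le> content (\<Union>i. U i)" by (rule outer_le) (use U in auto)
  also have "\<dots> \<le> (\<Sum>i. content (U i))" by (rule content_UN) (rule U)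
  also have "\<dots> \<le> (\<Sum>i. outer (A i) + ennreal (e * (1/2)^Suc i))"
    by (intro suminf_le U) auto
  also have "\<dots> = (\<Sum>i. outer (A i)) + (\<Sum>i. ennreal e * ennreal ((1/2) ^ Suc i))"
    using e by (subst suminf_add[symmetric])
       (auto simp del: ennreal_suminf_cmult simp add: ennreal_mult[symmetric])
  also have "\<dots> = (\<Sum>i. outer (A i)) + ennreal e"
    unfolding ennreal_suminf_cmult
    by (subst suminf_ennreal_eq[OF zero_le_power power_half_series]) auto
  finally show "outer (\<Union>i. A i) \<le> (\<Sum>i. outer (A i)) + ennreal e" .
qed

lemma outer_measure_space: "outer_measure_space (Pow UNIV) outer"
  unfolding outer_measure_space_def
  using outer_open[of "{}"] outer_UN
  by (auto simp: positive_def increasing_def countably_subadditive_def content_empty intro: outer_mono)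

lemma outer_Un: "outer (A \<union> B) \<le> outer A + outer B"
proof -
  have "outer (\<Union>i::nat. if i = 0 then A else if i = 1 then B else {})
      \<le> (\<Sum>i. outer (if i = 0 then A else if i = 1 then B else {}))"
    by (rule outer_UN)
  also have "(\<Union>i::nat. if i = 0 then A else if i = 1 then B else {}) = A \<union> B"
    by (auto split: if_splits)
  also have "(\<Sum>i. outer (if i = (0::nat) then A else if i = 1 then B else {})) =
     (\<Sum>i<2. outer (if i = (0::nat) then A else if i = 1 then B else {}))"
    by (rule suminf_finite) (use outer_open[of "{}"] in \<open>auto simp: content_empty\<close>)
  finally show ?thesis by (simp add: numeral_2_eq_2)
qed

text \<open>
  The Caratheodory condition for \<open>V\<close> on open test sets.  If \<open>f\<close> is nearly optimal below \<open>U \<inter> V\<close>, then every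
  \<open>g\<close> below the open set \<open>U \<inter> {f < e}\<close>, which contains \<open>U - V\<close>, vanishes where the truncation of \<open>f\<close> does not,
  so that their sum is again below \<open>U\<close>.
\<close>

lemma content_split:
  assumes "open U" "open V"
  shows "content (U \<inter> V) + outer (U - V) \<le> content U"
  unfolding content_def[of "U \<inter> V"] ennreal_SUP_add_left[OF below_ne, symmetric]
proof (rule SUP_least, rule ennreal_le_epsilon)
  fix f and e :: real assume f: "f \<in> below (U \<inter> V)" and e: "0 < e"
  have cf: "continuous_on UNIV f" using f by (auto simp: below_def)
  define f' where "f' = (\<lambda>x. max 0 (f x - e))"
  have f': "f' \<in> below ((U \<inter> V) \<inter> {x. e < f x})" "L f \<le> L f' + e"
    unfolding f'_def by (rule cut_below[OF f less_imp_le[OF e]])+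
  have "open {x. f x < e}" by (intro open_Collect_less cf continuous_intros)
  then have "outer (U - V) \<le> content (U \<inter> {x. f x < e})"
    using \<open>open U\<close> f e by (intro outer_le) (auto simp: below_def)
  then have "ennreal (L f') + outer (U - V) \<le> ennreal (L f') + content (U \<inter> {x. f x < e})"
    by (rule add_left_mono)
  also have "\<dots> \<le> content U"
    unfolding content_def[of "U \<inter> {x. f x < e}"] ennreal_SUP_add_right[OF below_ne]
  proof (rule SUP_least)
    fix g assume g: "g \<in> below (U \<inter> {x. f x < e})"
    have fg: "f' x = 0 \<or> g x = 0" for x
      using g by (cases "f x < e") (auto simp: f'_def below_def)
    have "f' x + g x \<le> 1" for x
      using fg[of x] f' g by (auto simp: below_def)
    then have "(\<lambda>x. f' x + g x) \<in> below U"
      using f'(1) g by (intro belowI continuous_intros) (auto simp: below_def)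
    moreover have "L (\<lambda>x. f' x + g x) = L f' + L g"
      using f' g by (intro add) (auto simp: below_def)
    ultimately have "ennreal (L f' + L g) \<le> content U"
      using content_ge by metis
    then show "ennreal (L f') + ennreal (L g) \<le> content U"
      using below_nonneg[OF f'(1)] below_nonneg[OF g] by simp
  qed
  finally have split: "ennreal (L f') + outer (U - V) \<le> content U" .
  have "ennreal (L f) \<le> ennreal (L f' + e)"
    using f'(2) by (rule ennreal_leI)
  then have "ennreal (L f) + outer (U - V) \<le> ennreal (L f' + e) + outer (U - V)"
    by (rule add_right_mono)
  also have "\<dots> = (ennreal (L f') + outer (U - V)) + ennreal e"
    using below_nonneg[OF f'(1)] e by (simp add: ac_simps)
  also have "\<dots> \<le> content U + ennreal e"
    using split by (rule add_right_mono)
  finally show "ennreal (L f) + outer (U - V) \<le> content U + ennreal e" .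
qed

lemma open_in_lambda_system:
  assumes "open V"
  shows "V \<in> lambda_system UNIV (Pow UNIV) outer"
proof -
  have "outer (A \<inter> V) + outer (A - V) = outer A" for A
  proof (rule antisym)
    show "outer (A \<inter> V) + outer (A - V) \<le> outer A"
      unfolding outer_def[of A]
    proof (rule INF_greatest, clarify)
      fix U assume U: "open U" "A \<subseteq> U"
      have "outer (A \<inter> V) + outer (A - V) \<le> content (U \<inter> V) + outer (U - V)"
        using U assms by (intro add_mono outer_le outer_mono) auto
      also have "\<dots> \<le> content U" using U assms by (intro content_split)
      finally show "outer (A \<inter> V) + outer (A - V) \<le> content U" .
    qed
    show "outer A \<le> outer (A \<inter> V) + outer (A - V)"
      using outer_Un[of "A \<inter> V" "A - V"] by (simp add: Int_Diff_Un)
  qed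
  then show ?thesis
    unfolding algebra.lambda_system_eq[OF algebra_Pow] by blast
qed

definition representing_measure :: "'a measure" where
  "representing_measure = measure_of UNIV (sets borel) outer"

lemma sets_representing [simp]: "sets representing_measure = sets borel"
  unfolding representing_measure_def
  by (metis sets.sigma_sets_eq sets_measure_of space_borel top_greatest Pow_UNIV)

lemma space_representing [simp]: "space representing_measure = UNIV"
  using sets_eq_imp_space_eq[OF sets_representing] by simp

lemma emeasure_representing:
  assumes "A \<in> sets borel"
  shows "emeasure representing_measure A = outer A"
proof -
  interpret sigma_algebra UNIV "Pow UNIV :: 'a set set" by (rule sigma_algebra_Pow)
  have ms: "measure_space UNIV (lambda_system UNIV (Pow UNIV) outer) outer"
    by (rule caratheodory_lemma[OF outer_measure_space])
  then have sa: "sigma_algebra UNIV (lambda_system UNIV (Pow UNIV) outer)"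
    by (simp add: measure_space_def)
  have "sets borel \<subseteq> lambda_system UNIV (Pow UNIV) outer"
    unfolding borel_def
    using sigma_algebra.sigma_sets_subset[OF sa, of "{S. open S}"] open_in_lambda_system
    by (auto simp: subset_iff)
  then have "measure_space UNIV (sets borel) outer"
    using measure_down[OF ms] sets.sigma_algebra_axioms[of borel] by simp
  then show ?thesis
    using assms unfolding representing_measure_def
    by (intro emeasure_measure_of_sigma) (auto simp: measure_space_def)
qed

lemma emeasure_representing_open: "open U \<Longrightarrow> emeasure representing_measure U = content U"
  by (simp add: emeasure_representing outer_open)

lemma prob_space_representing: "prob_space representing_measure"
  by (rule prob_spaceI) (simp add: emeasure_representing_open content_UNIV)

text \<open>
  Outer regularity is built into the definition of \<open>outer\<close>; inner regularity is outer regularity of the complement,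
  as closed sets are compact.
\<close>

lemma regular_representing: "regular_borel representing_measure"
  unfolding regular_borel_def
proof (intro conjI ballI)
  interpret prob_space representing_measure by (rule prob_space_representing)
  fix A :: "'a set" assume A: "A \<in> sets borel"
  show "emeasure representing_measure A =
      (INF U\<in>{U. open U \<and> A \<subseteq> U}. emeasure representing_measure U)"
    unfolding emeasure_representing[OF A] outer_def
    by (intro INF_cong) (auto simp: emeasure_representing_open)
  show "emeasure representing_measure A =
      (SUP K\<in>{K. compact K \<and> K \<subseteq> A}. emeasure representing_measure K)" (is "_ = ?S")
  proof (rule antisym)
    show "emeasure representing_measure A \<le> ?S"
    proof (rule ennreal_le_epsilon)
      fix e :: real assume e: "0 < e"
      obtain U where U: "open U" "- A \<subseteq> U" "content U \<le> outer (- A) + ennreal e"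
        using outer_approx[OF e] .
      have cA: "- A \<in> sets borel" using A by (metis borel_comp)
      have K: "compact (- U)" using compact_Int_closed[OF compact_space closed_Compl[OF U(1)]] by simp
      have UA: "U \<in> sets borel" using U by simp
      have "measure representing_measure U \<le> measure representing_measure (- A) + e"
        using U(3) e unfolding emeasure_representing_open[OF U(1), symmetric]
          emeasure_representing[OF cA, symmetric] emeasure_eq_measure
        by (simp flip: ennreal_plus)
      moreover have "measure representing_measure (- A) = 1 - measure representing_measure A"
        using prob_compl[of A] A by (simp add: Compl_eq_Diff_UNIV)
      moreover have "measure representing_measure (- U) = 1 - measure representing_measure U"
        using prob_compl[of U] UA by (simp add: Compl_eq_Diff_UNIV)
      ultimately have "measure representing_measure A \<le> measure representing_measure (- U) + e"
        by simp
      then have "emeasure representing_measure A \<le> emeasure representing_measure (- U) + ennreal e"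
        using e by (simp add: emeasure_eq_measure flip: ennreal_plus)
      moreover have "emeasure representing_measure (- U) \<le> ?S"
        using K U(2) by (intro SUP_upper) auto
      ultimately show "emeasure representing_measure A \<le> ?S + ennreal e"
        by (meson add_right_mono order_trans)
    qed
    show "?S \<le> emeasure representing_measure A"
      by (intro SUP_least emeasure_mono) (auto simp: A)
  qed
qed simp

lemma integrable_representing:
  assumes "continuous_on UNIV f"
  shows "integrable representing_measure (f :: 'a \<Rightarrow> real)"
proof -
  interpret prob_space representing_measure by (rule prob_space_representing)
  have "f \<in> borel_measurable borel" using assms by (rule borel_measurable_continuous_onI)
  then have "f \<in> borel_measurable representing_measure"
    by (simp cong: measurable_cong_sets)
  moreover have "compact (f ` UNIV)" using assms compact_space by (rule compact_continuous_image)
  then have "bounded (range f)" by (rule compact_imp_bounded)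
  then obtain B where "\<And>x. norm (f x) \<le> B" by (auto simp: bounded_iff)
  ultimately show ?thesis by (intro integrable_const_bound[of _ B]) auto
qed

text \<open>
  The layer-cake decomposition: the \<open>k\<close>-th summand is the part of \<open>y\<close> between the heights \<open>k\<close> and \<open>k + 1\<close>.
\<close>

lemma sum_truncations:
  fixes y :: real
  assumes "0 \<le> y"
  shows "(\<Sum>k<n. min 1 (max 0 (y - real k))) = min (real n) y"
  using assms by (induction n) (auto simp: min_def max_def)

lemma L_sum:
  fixes n :: nat
  assumes "\<And>k. k < n \<Longrightarrow> continuous_on UNIV (f k)"
  shows "L (\<lambda>x. \<Sum>k<n. f k x) = (\<Sum>k<n. L (f k))"
  using assms
proof (induction n)
  case (Suc n)
  have "L (\<lambda>x. (\<Sum>k<n. f k x) + f n x) = L (\<lambda>x. \<Sum>k<n. f k x) + L (f n)"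
    by (intro add continuous_on_sum Suc.prems) auto
  then show ?case using Suc by simp
qed (simp add: const)

text \<open>
  The layer between the heights \<open>k/n\<close> and \<open>(k+1)/n\<close> of \<open>f\<close> is below the open set \<open>{f > k/n}\<close> and above the indicator
  of \<open>{f > (k+1)/n}\<close>.  Comparing each layer with the integral of the previous one loses only one layer,
  that is \<open>1/n\<close>.
\<close>

lemma below_le_integral:
  assumes f: "f \<in> below UNIV"
  shows "L f \<le> (\<integral>x. f x \<partial>representing_measure)"
proof -
  let ?\<nu> = representing_measure
  let ?I = "\<integral>x. f x \<partial>?\<nu>"
  interpret prob_space ?\<nu> by (rule prob_space_representing)
  have cf: "continuous_on UNIV f" using f by (rule belowD)
  have bound: "real (Suc m) * L f \<le> 1 + real (Suc m) * ?I" for m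
  proof -
    define g where "g k x = min 1 (max 0 (real (Suc m) * f x - real k))" for k x
    have cg: "continuous_on UNIV (g k)" for k
      unfolding g_def by (intro continuous_intros cf)
    have layers: "(\<Sum>k<Suc m. g k x) = real (Suc m) * f x" for x
      unfolding g_def using belowD(2,3)[OF f, of x]
      by (subst sum_truncations) (auto intro!: min_absorb2 mult_left_le)
    have open_layer: "open {x. real k < real (Suc m) * f x}" for k
      by (intro open_Collect_less continuous_intros cf)
    have gl: "L (g k) \<le> measure ?\<nu> {x. real k < real (Suc m) * f x}" for k
    proof -
      have "g k \<in> below {x. real k < real (Suc m) * f x}"
        by (intro belowI cg) (auto simp: g_def)
      then have "ennreal (L (g k)) \<le> emeasure ?\<nu> {x. real k < real (Suc m) * f x}"
        unfolding emeasure_representing_open[OF open_layer] by (rule content_ge)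
      then show ?thesis by (simp add: emeasure_eq_measure)
    qed
    have gi: "measure ?\<nu> {x. real (Suc k) < real (Suc m) * f x} \<le> (\<integral>x. g k x \<partial>?\<nu>)" for k
    proof -
      have m: "{x. real (Suc k) < real (Suc m) * f x} \<in> sets ?\<nu>"
        using borel_open[OF open_layer[of "Suc k"]] by simp
      have "measure ?\<nu> {x. real (Suc k) < real (Suc m) * f x} =
          (\<integral>x. indicator {x. real (Suc k) < real (Suc m) * f x} x \<partial>?\<nu>)"
        using m by simp
      also have "\<dots> \<le> (\<integral>x. g k x \<partial>?\<nu>)"
        by (intro integral_mono integrable_representing cg integrable_real_indicator m)
           (auto simp: g_def indicator_def emeasure_eq_measure)
      finally show ?thesis .
    qed
    have "real (Suc m) * L f = L (\<lambda>x. \<Sum>k<Suc m. g k x)"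
      unfolding layers by (rule scale[OF cf, symmetric])
    also have "\<dots> = (\<Sum>k<Suc m. L (g k))" by (rule L_sum) (rule cg)
    also have "\<dots> \<le> (\<Sum>k<Suc m. measure ?\<nu> {x. real k < real (Suc m) * f x})"
      by (rule sum_mono) (rule gl)
    also have "\<dots> = measure ?\<nu> {x. 0 < real (Suc m) * f x} +
        (\<Sum>k<m. measure ?\<nu> {x. real (Suc k) < real (Suc m) * f x})"
      by (subst sum.lessThan_Suc_shift) simp
    also have "\<dots> \<le> 1 + (\<Sum>k<m. \<integral>x. g k x \<partial>?\<nu>)"
      by (intro add_mono sum_mono gi prob_le_1)
    also have "\<dots> \<le> 1 + (\<Sum>k<Suc m. \<integral>x. g k x \<partial>?\<nu>)"
      by (auto intro!: integral_nonneg_AE simp: g_def)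
    also have "(\<Sum>k<Suc m. \<integral>x. g k x \<partial>?\<nu>) = (\<integral>x. (\<Sum>k<Suc m. g k x) \<partial>?\<nu>)"
      by (intro Bochner_Integration.integral_sum[symmetric] integrable_representing cg)
    also have "\<dots> = real (Suc m) * ?I" unfolding layers by simp
    finally show ?thesis by simp
  qed
  show ?thesis
  proof (rule ccontr)
    assume "\<not> ?thesis"
    then have "0 < L f - ?I" by simp
    then obtain n where "1 < real n * (L f - ?I)"
      using reals_Archimedean3 by blast
    moreover have "real n * (L f - ?I) \<le> real (Suc n) * (L f - ?I)"
      using \<open>0 < L f - ?I\<close> by simp
    ultimately show False using bound[of n] by (simp add: algebra_simps)
  qed
qed

text \<open>
  The one-sided estimate suffices: applied to both \<open>h\<close> and \<open>1 - h\<close> it gives equality for \<open>0 \<le> h \<le> 1\<close>, and every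
  continuous function is an affine image of such an \<open>h\<close>.
\<close>

lemma integral_representing:
  assumes f: "continuous_on UNIV f"
  shows "L f = (\<integral>x. f x \<partial>representing_measure)"
proof -
  let ?\<nu> = representing_measure
  interpret prob_space ?\<nu> by (rule prob_space_representing)
  have "bounded (range f)"
    using f compact_space by (intro compact_imp_bounded compact_continuous_image)
  then obtain B0 where B0: "\<And>x. norm (f x) \<le> B0" by (auto simp: bounded_iff)
  define B where "B = max 1 B0"
  have B: "1 \<le> B" "\<And>x. \<bar>f x\<bar> \<le> B" using B0 by (auto simp: B_def le_max_iff_disj)
  define h where "h x = (1 / (2 * B)) * f x + 1 / 2" for x
  have ch: "continuous_on UNIV h" unfolding h_def by (intro continuous_intros f)
  have hr: "0 \<le> h x" "h x \<le> 1" for x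
    using B(1) B(2)[of x] by (simp_all add: h_def field_simps abs_le_iff)
  have "h \<in> below UNIV" "(\<lambda>x. 1 - h x) \<in> below UNIV"
    using hr by (auto intro!: belowI continuous_intros ch)
  note below_le_integral[OF this(1)] below_le_integral[OF this(2)]
  moreover have "L (\<lambda>x. h x + (1 - h x)) = L h + L (\<lambda>x. 1 - h x)"
    by (intro add continuous_intros ch)
  moreover have "(\<integral>x. 1 - h x \<partial>?\<nu>) = 1 - (\<integral>x. h x \<partial>?\<nu>)"
    using integrable_representing[OF ch] prob_space by simp
  ultimately have Lh: "L h = (\<integral>x. h x \<partial>?\<nu>)" using one by simp
  have "L h = L (\<lambda>x. (1 / (2 * B)) * f x) + 1 / 2"
    unfolding h_def using B(1) by (subst add) (auto intro!: continuous_intros f simp: const)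
  then have "L h = (1 / (2 * B)) * L f + 1 / 2" using scale[OF f, of "1 / (2 * B)"] by simp
  moreover have "(\<integral>x. h x \<partial>?\<nu>) = (1 / (2 * B)) * (\<integral>x. f x \<partial>?\<nu>) + 1 / 2"
    unfolding h_def using integrable_representing[OF f] prob_space by simp
  ultimately show ?thesis using Lh B(1) by (simp add: field_simps)
qed

text \<open>
  The invariance of \<open>L\<close> gives \<open>\<nu>(U) \<le> \<nu>(\<alpha>\<^sup>-\<^sup>1 U)\<close> for open \<open>U\<close>, hence the opposite inequality for compact sets.  Inner
  regularity extends this to Borel sets: a compact \<open>K \<subseteq> \<alpha>\<^sup>-\<^sup>1 A\<close> is contained in the preimage of the compact set
  \<open>\<alpha>(K) \<subseteq> A\<close>.  Two probability measures that are comparable on all sets are equal.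
\<close>

lemma invariant_representing:
  assumes cont: "continuous_on UNIV \<alpha>"
    and inv: "\<And>f. continuous_on UNIV f \<Longrightarrow> L (\<lambda>x. f (\<alpha> x)) = L f"
  shows "distr representing_measure borel \<alpha> = representing_measure"
proof -
  let ?\<nu> = representing_measure
  let ?\<nu>' = "distr ?\<nu> borel \<alpha>"
  interpret prob_space ?\<nu> by (rule prob_space_representing)
  have "\<alpha> \<in> borel_measurable borel" using cont by (rule borel_measurable_continuous_onI)
  then have meas: "\<alpha> \<in> measurable ?\<nu> borel" by (simp cong: measurable_cong_sets)
  interpret image: prob_space ?\<nu>' using meas by (rule prob_space_distr)
  have pre: "\<alpha> -` A \<in> sets borel" if "A \<in> sets borel" for A
    using measurable_sets[OF meas that] by simp
  have em': "emeasure ?\<nu>' A = emeasure ?\<nu> (\<alpha> -` A)" if "A \<in> sets borel" for A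
    using emeasure_distr[OF meas that] by simp
  have open_le: "emeasure ?\<nu> U \<le> emeasure ?\<nu>' U" if U: "open U" for U
  proof -
    have "open (\<alpha> -` U)" using cont U open_vimage by blast
    have "content U \<le> content (\<alpha> -` U)"
      unfolding content_def[of U]
    proof (rule SUP_least)
      fix f assume f: "f \<in> below U"
      have "continuous_on UNIV (\<lambda>x. f (\<alpha> x))"
        using continuous_on_compose2[OF belowD(1)[OF f] cont] by simp
      then have "(\<lambda>x. f (\<alpha> x)) \<in> below (\<alpha> -` U)"
        using f by (auto simp: below_def)
      then show "ennreal (L f) \<le> content (\<alpha> -` U)"
        using content_ge inv[OF belowD(1)[OF f]] by metis
    qed
    then show ?thesis
      using U \<open>open (\<alpha> -` U)\<close> by (simp add: em' emeasure_representing_open)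
  qed
  have compact_le: "measure ?\<nu>' K \<le> measure ?\<nu> K" if "compact K" for K
  proof -
    have K: "closed K" using that by (rule compact_imp_closed)
    have "emeasure ?\<nu> (- K) \<le> emeasure ?\<nu>' (- K)" using K by (intro open_le open_Compl)
    then have "measure ?\<nu> (- K) \<le> measure ?\<nu>' (- K)"
      by (simp add: emeasure_eq_measure image.emeasure_eq_measure)
    moreover have "measure ?\<nu> (- K) = 1 - measure ?\<nu> K"
      using prob_compl[of K] K by (simp add: Compl_eq_Diff_UNIV)
    moreover have "measure ?\<nu>' (- K) = 1 - measure ?\<nu>' K"
      using image.prob_compl[of K] K by (simp add: Compl_eq_Diff_UNIV)
    ultimately show ?thesis by simp
  qed
  have le: "measure ?\<nu>' A \<le> measure ?\<nu> A" if A: "A \<in> sets borel" for A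
  proof -
    have "emeasure ?\<nu>' A = (SUP K\<in>{K. compact K \<and> K \<subseteq> \<alpha> -` A}. emeasure ?\<nu> K)"
      using regular_representing pre[OF A] unfolding em'[OF A] regular_borel_def by blast
    also have "\<dots> \<le> emeasure ?\<nu> A"
    proof (rule SUP_least, clarify)
      fix K assume K: "compact K" "K \<subseteq> \<alpha> -` A"
      have aK: "compact (\<alpha> ` K)"
        using K(1) continuous_on_subset[OF cont] by (intro compact_continuous_image) auto
      then have saK: "\<alpha> ` K \<in> sets borel" by (intro borel_closed compact_imp_closed)
      have "emeasure ?\<nu> K \<le> emeasure ?\<nu> (\<alpha> -` (\<alpha> ` K))"
        using pre[OF saK] by (intro emeasure_mono) auto
      also have "\<dots> = emeasure ?\<nu>' (\<alpha> ` K)" by (rule em'[OF saK, symmetric])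
      also have "\<dots> \<le> emeasure ?\<nu> (\<alpha> ` K)"
        using compact_le[OF aK] by (simp add: emeasure_eq_measure image.emeasure_eq_measure)
      also have "\<dots> \<le> emeasure ?\<nu> A" using K(2) A by (intro emeasure_mono) auto
      finally show "emeasure ?\<nu> K \<le> emeasure ?\<nu> A" .
    qed
    finally show ?thesis by (simp add: emeasure_eq_measure image.emeasure_eq_measure)
  qed
  show ?thesis
  proof (rule measure_eqI)
    fix A assume "A \<in> sets ?\<nu>'"
    then have A: "A \<in> sets borel" by simp
    then have "- A \<in> sets borel" by (metis borel_comp)
    then have "measure ?\<nu>' (- A) \<le> measure ?\<nu> (- A)" by (rule le)
    moreover have "measure ?\<nu> (- A) = 1 - measure ?\<nu> A"
      using prob_compl[of A] A by (simp add: Compl_eq_Diff_UNIV)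
    moreover have "measure ?\<nu>' (- A) = 1 - measure ?\<nu>' A"
      using image.prob_compl[of A] A by (simp add: Compl_eq_Diff_UNIV)
    ultimately have "measure ?\<nu>' A = measure ?\<nu> A" using le[OF A] by simp
    then show "emeasure ?\<nu>' A = emeasure ?\<nu> A"
      by (simp add: emeasure_eq_measure image.emeasure_eq_measure)
  qed simp
qed

end

section \<open>Exponential growth along a measure-preserving map\<close>

definition birkhoff_sum :: "('a \<Rightarrow> 'a) \<Rightarrow> ('a \<Rightarrow> real) \<Rightarrow> nat \<Rightarrow> 'a \<Rightarrow> real" where
  "birkhoff_sum \<alpha> \<psi> n x = (\<Sum>k<n. \<psi> ((\<alpha> ^^ k) x))"

text \<open>
  The function \<open>x \<mapsto> exp (S\<^sub>n\<psi>(x)) w(\<alpha>\<^sup>n x)\<close> is the \<open>n\<close>-th iterate on \<open>w\<close> of the weighted composition operator with weight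
  \<open>e\<^sup>\<psi>\<close>, so \<open>growth_rate\<close> is the logarithm of the growth rate of its powers on \<open>L\<^sup>1(\<mu>)\<close>.  As an infimum of admissible
  rates it needs neither the limit in the spectral radius formula nor operator norms.
\<close>

definition growth_exponents :: "'a measure \<Rightarrow> ('a \<Rightarrow> 'a) \<Rightarrow> ('a \<Rightarrow> real) \<Rightarrow> real set" where
  "growth_exponents \<mu> \<alpha> \<psi> = {s. \<exists>C\<ge>0. \<forall>n. \<forall>w\<in>borel_measurable \<mu>. (\<forall>x. 0 \<le> w x) \<longrightarrow>
     (\<integral>\<^sup>+x. ennreal (exp (birkhoff_sum \<alpha> \<psi> n x) * w ((\<alpha> ^^ n) x)) \<partial>\<mu>)
       \<le> ennreal (C * exp (s * n)) * (\<integral>\<^sup>+x. ennreal (w x) \<partial>\<mu>)}"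

definition growth_rate :: "'a measure \<Rightarrow> ('a \<Rightarrow> 'a) \<Rightarrow> ('a \<Rightarrow> real) \<Rightarrow> real" where
  "growth_rate \<mu> \<alpha> \<psi> = Inf (growth_exponents \<mu> \<alpha> \<psi>)"

lemma birkhoff_sum_0 [simp]: "birkhoff_sum \<alpha> \<psi> 0 x = 0"
  by (simp add: birkhoff_sum_def)

lemma birkhoff_sum_add:
  "birkhoff_sum \<alpha> \<psi> (m + n) x = birkhoff_sum \<alpha> \<psi> m x + birkhoff_sum \<alpha> \<psi> n ((\<alpha> ^^ m) x)"
proof (induction n)
  case (Suc n)
  have "(\<alpha> ^^ (m + n)) x = (\<alpha> ^^ n) ((\<alpha> ^^ m) x)"
    by (subst add.commute) (simp add: funpow_add)
  then show ?case using Suc by (simp add: birkhoff_sum_def)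
qed simp

lemma birkhoff_sum_Suc:
  "birkhoff_sum \<alpha> \<psi> (Suc n) x = \<psi> x + birkhoff_sum \<alpha> \<psi> n (\<alpha> x)"
  using birkhoff_sum_add[of \<alpha> \<psi> 1 n x] by (simp add: birkhoff_sum_def)

lemma birkhoff_sum_bound:
  assumes "\<And>x. \<bar>\<psi> x\<bar> \<le> B"
  shows "\<bar>birkhoff_sum \<alpha> \<psi> n x\<bar> \<le> real n * B"
proof -
  have "\<bar>birkhoff_sum \<alpha> \<psi> n x\<bar> \<le> (\<Sum>k<n. \<bar>\<psi> ((\<alpha> ^^ k) x)\<bar>)"
    unfolding birkhoff_sum_def by (rule sum_abs)
  also have "\<dots> \<le> (\<Sum>k<n. B)" by (rule sum_mono) (rule assms)
  finally show ?thesis by simp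
qed

locale measure_preserving_system =
  fixes \<mu> :: "'a measure" and \<alpha> :: "'a \<Rightarrow> 'a"
  assumes measurable_map [measurable]: "\<alpha> \<in> measurable \<mu> \<mu>"
    and distr_map: "distr \<mu> \<mu> \<alpha> = \<mu>"
    and positive_finite: "\<exists>A\<in>sets \<mu>. 0 < emeasure \<mu> A \<and> emeasure \<mu> A < \<infinity>"
begin

lemma measurable_iterate [measurable]: "(\<alpha> ^^ n) \<in> measurable \<mu> \<mu>"
proof (induction n)
  case (Suc n)
  then show ?case by (simp add: measurable_comp[OF _ measurable_map])
qed (simp add: id_def)

lemma distr_iterate: "distr \<mu> \<mu> (\<alpha> ^^ n) = \<mu>"
proof (induction n)
  case 0
  show ?case by (simp add: distr_id2 id_def)
next
  case (Suc n)
  have "distr \<mu> \<mu> (\<alpha> ^^ Suc n) = distr (distr \<mu> \<mu> (\<alpha> ^^ n)) \<mu> \<alpha>"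
    by (simp add: distr_distr del: funpow.simps) simp
  then show ?case using Suc distr_map by (simp del: funpow.simps)
qed

lemma nn_integral_iterate:
  assumes [measurable]: "f \<in> borel_measurable \<mu>"
  shows "(\<integral>\<^sup>+x. f ((\<alpha> ^^ n) x) \<partial>\<mu>) = (\<integral>\<^sup>+x. f x \<partial>\<mu>)"
  using nn_integral_distr[of "\<alpha> ^^ n" \<mu> \<mu> f] by (simp add: distr_iterate)

lemma measurable_birkhoff_sum [measurable (raw)]:
  assumes [measurable]: "\<psi> \<in> borel_measurable \<mu>"
  shows "birkhoff_sum \<alpha> \<psi> n \<in> borel_measurable \<mu>"
  unfolding birkhoff_sum_def[abs_def] by measurable

lemma nn_integral_birkhoff_le:
  assumes w: "w \<in> borel_measurable \<mu>" "\<And>x. 0 \<le> w x" and c: "\<And>x. birkhoff_sum \<alpha> \<psi> n x \<le> c"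
  shows "(\<integral>\<^sup>+x. ennreal (exp (birkhoff_sum \<alpha> \<psi> n x) * w ((\<alpha> ^^ n) x)) \<partial>\<mu>)
     \<le> ennreal (exp c) * (\<integral>\<^sup>+x. ennreal (w x) \<partial>\<mu>)"
proof -
  note w(1)[measurable]
  have "(\<integral>\<^sup>+x. ennreal (exp (birkhoff_sum \<alpha> \<psi> n x) * w ((\<alpha> ^^ n) x)) \<partial>\<mu>)
      \<le> (\<integral>\<^sup>+x. ennreal (exp c) * ennreal (w ((\<alpha> ^^ n) x)) \<partial>\<mu>)"
    using c w(2) by (intro nn_integral_mono) (simp flip: ennreal_mult' add: mult_right_mono ennreal_leI)
  also have "\<dots> = ennreal (exp c) * (\<integral>\<^sup>+x. ennreal (w ((\<alpha> ^^ n) x)) \<partial>\<mu>)"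
    by (rule nn_integral_cmult) measurable
  also have "(\<integral>\<^sup>+x. ennreal (w ((\<alpha> ^^ n) x)) \<partial>\<mu>) = (\<integral>\<^sup>+x. ennreal (w x) \<partial>\<mu>)"
    by (rule nn_integral_iterate[of "\<lambda>x. ennreal (w x)"]) measurable
  finally show ?thesis .
qed

lemma growth_exponentsI:
  assumes "0 \<le> C"
    and "\<And>n w. w \<in> borel_measurable \<mu> \<Longrightarrow> (\<And>x. 0 \<le> w x) \<Longrightarrow>
     (\<integral>\<^sup>+x. ennreal (exp (birkhoff_sum \<alpha> \<psi> n x) * w ((\<alpha> ^^ n) x)) \<partial>\<mu>)
       \<le> ennreal (C * exp (s * real n)) * (\<integral>\<^sup>+x. ennreal (w x) \<partial>\<mu>)"
  shows "s \<in> growth_exponents \<mu> \<alpha> \<psi>"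
  using assms unfolding growth_exponents_def by blast

lemma growth_exponentsE:
  assumes "s \<in> growth_exponents \<mu> \<alpha> \<psi>"
  obtains C where "0 \<le> C"
    and "\<And>n w. w \<in> borel_measurable \<mu> \<Longrightarrow> (\<And>x. 0 \<le> w x) \<Longrightarrow>
     (\<integral>\<^sup>+x. ennreal (exp (birkhoff_sum \<alpha> \<psi> n x) * w ((\<alpha> ^^ n) x)) \<partial>\<mu>)
       \<le> ennreal (C * exp (s * real n)) * (\<integral>\<^sup>+x. ennreal (w x) \<partial>\<mu>)"
  using assms unfolding growth_exponents_def by blast

lemma bound_in_growth_exponents:
  assumes "\<And>x. \<bar>\<psi> x\<bar> \<le> B"
  shows "B \<in> growth_exponents \<mu> \<alpha> \<psi>"
proof (rule growth_exponentsI[of 1])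
  fix n :: nat and w :: "'a \<Rightarrow> real" assume w: "w \<in> borel_measurable \<mu>" "\<And>x. 0 \<le> w x"
  have "birkhoff_sum \<alpha> \<psi> n x \<le> B * real n" for x
    using birkhoff_sum_bound[of \<psi> B \<alpha> n x] assms by (simp add: mult.commute)
  from nn_integral_birkhoff_le[OF w this]
  show "(\<integral>\<^sup>+x. ennreal (exp (birkhoff_sum \<alpha> \<psi> n x) * w ((\<alpha> ^^ n) x)) \<partial>\<mu>)
       \<le> ennreal (1 * exp (B * real n)) * (\<integral>\<^sup>+x. ennreal (w x) \<partial>\<mu>)" by simp
qed simp

text \<open>
  Tested on the indicator of a set of positive finite measure, the integrals are at least \<open>e\<^bsup>-nB\<^esup>\<close> times that measure.
\<close>

lemma growth_exponents_ge:
  assumes B: "\<And>x. \<bar>\<psi> x\<bar> \<le> B" and s: "s \<in> growth_exponents \<mu> \<alpha> \<psi>"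
  shows "- B \<le> s"
proof (rule ccontr)
  assume "\<not> - B \<le> s"
  then have neg: "s + B < 0" by simp
  obtain C where C: "0 \<le> C" and le: "\<And>n w. w \<in> borel_measurable \<mu> \<Longrightarrow> (\<And>x. 0 \<le> w x) \<Longrightarrow>
     (\<integral>\<^sup>+x. ennreal (exp (birkhoff_sum \<alpha> \<psi> n x) * w ((\<alpha> ^^ n) x)) \<partial>\<mu>)
       \<le> ennreal (C * exp (s * real n)) * (\<integral>\<^sup>+x. ennreal (w x) \<partial>\<mu>)"
    using growth_exponentsE[OF s] by metis
  obtain A where A [measurable]: "A \<in> sets \<mu>" and A_pos: "0 < emeasure \<mu> A" "emeasure \<mu> A < \<infinity>"
    using positive_finite by blast
  define w where "w = (indicator A :: 'a \<Rightarrow> real)"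
  have w [measurable]: "w \<in> borel_measurable \<mu>" and w0: "\<And>x. 0 \<le> w x"
    by (simp_all add: w_def)
  have Iw: "(\<integral>\<^sup>+x. ennreal (w x) \<partial>\<mu>) = emeasure \<mu> A"
    by (simp add: w_def ennreal_indicator)
  define a where "a = measure \<mu> A"
  have "emeasure \<mu> A = ennreal a"
    using A_pos(2) unfolding a_def by (intro emeasure_eq_ennreal_measure) auto
  then have a: "emeasure \<mu> A = ennreal a" "0 < a" using A_pos(1) by auto
  have "exp (- B * real n) * a \<le> C * exp (s * real n) * a" for n
  proof -
    have "ennreal (exp (- B * real n)) * ennreal a
        = ennreal (exp (- B * real n)) * (\<integral>\<^sup>+x. ennreal (w ((\<alpha> ^^ n) x)) \<partial>\<mu>)"
      using Iw a nn_integral_iterate[of "\<lambda>x. ennreal (w x)" n] by simp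
    also have "\<dots> = (\<integral>\<^sup>+x. ennreal (exp (- B * real n)) * ennreal (w ((\<alpha> ^^ n) x)) \<partial>\<mu>)"
      by (rule nn_integral_cmult[symmetric]) measurable
    also have "\<dots> \<le> (\<integral>\<^sup>+x. ennreal (exp (birkhoff_sum \<alpha> \<psi> n x) * w ((\<alpha> ^^ n) x)) \<partial>\<mu>)"
    proof (rule nn_integral_mono)
      fix x
      have "- B * real n \<le> birkhoff_sum \<alpha> \<psi> n x"
        using birkhoff_sum_bound[of \<psi> B \<alpha> n x] B by (simp add: mult.commute)
      then show "ennreal (exp (- B * real n)) * ennreal (w ((\<alpha> ^^ n) x))
          \<le> ennreal (exp (birkhoff_sum \<alpha> \<psi> n x) * w ((\<alpha> ^^ n) x))"
        using w0 by (simp flip: ennreal_mult' add: mult_right_mono ennreal_leI)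
    qed
    also have "\<dots> \<le> ennreal (C * exp (s * real n)) * ennreal a"
      using le[OF w w0, of n] by (simp add: Iw a)
    finally show ?thesis using C a by (simp flip: ennreal_mult')
  qed
  then have bound: "exp (- B * real n) \<le> C * exp (s * real n)" for n
    using a by simp
  have "1 \<le> C * exp (s + B) ^ n" for n
  proof -
    have "exp (- B * real n) * exp (B * real n) \<le> C * exp (s * real n) * exp (B * real n)"
      using bound by (rule mult_right_mono) simp
    also have "\<dots> = C * exp (s + B) ^ n"
      by (simp add: exp_of_nat_mult[symmetric] exp_add[symmetric] algebra_simps)
    finally show ?thesis by (simp add: exp_add[symmetric])
  qed
  moreover have "(\<lambda>n. C * exp (s + B) ^ n) \<longlonglongrightarrow> C * 0"
    using neg by (intro tendsto_mult_left LIMSEQ_power_zero) simp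
  ultimately show False
    using LIMSEQ_le_const[of "\<lambda>n. C * exp (s + B) ^ n" 0 1] by auto
qed

lemma growth_exponents_bdd_below:
  assumes "\<And>x. \<bar>\<psi> x\<bar> \<le> B"
  shows "bdd_below (growth_exponents \<mu> \<alpha> \<psi>)"
  using growth_exponents_ge[OF assms] by (rule bdd_belowI)

lemma growth_exponents_above:
  assumes B: "\<And>x. \<bar>\<psi> x\<bar> \<le> B" and "growth_rate \<mu> \<alpha> \<psi> < t"
  obtains s where "s \<in> growth_exponents \<mu> \<alpha> \<psi>" "s < t"
  using that assms(2) cInf_lessD[of "growth_exponents \<mu> \<alpha> \<psi>" t]
    bound_in_growth_exponents[of \<psi>, OF B]
  unfolding growth_rate_def by blast

text \<open>
  Bounded perturbations of the Birkhoff sums do not affect the growth rate.  Monotonicity, translation by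
  constants and the triviality of coboundaries are all instances.
\<close>

lemma growth_rate_le:
  assumes \<phi>: "\<And>x. \<bar>\<phi> x\<bar> \<le> A" and \<psi>: "\<And>x. \<bar>\<psi> x\<bar> \<le> B"
    and [measurable]: "\<psi> \<in> borel_measurable \<mu>"
    and le: "\<And>n x. birkhoff_sum \<alpha> \<phi> n x \<le> birkhoff_sum \<alpha> \<psi> n x + c * real n + D"
  shows "growth_rate \<mu> \<alpha> \<phi> \<le> growth_rate \<mu> \<alpha> \<psi> + c"
proof -
  have "growth_rate \<mu> \<alpha> \<phi> - c \<le> s" if s: "s \<in> growth_exponents \<mu> \<alpha> \<psi>" for s
  proof -
    obtain C where C: "0 \<le> C" and Cle: "\<And>n w. w \<in> borel_measurable \<mu> \<Longrightarrow> (\<And>x. 0 \<le> w x) \<Longrightarrow>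
       (\<integral>\<^sup>+x. ennreal (exp (birkhoff_sum \<alpha> \<psi> n x) * w ((\<alpha> ^^ n) x)) \<partial>\<mu>)
         \<le> ennreal (C * exp (s * real n)) * (\<integral>\<^sup>+x. ennreal (w x) \<partial>\<mu>)"
      using growth_exponentsE[OF s] by metis
    have "s + c \<in> growth_exponents \<mu> \<alpha> \<phi>"
    proof (rule growth_exponentsI[of "C * exp D"])
      fix n :: nat and w :: "'a \<Rightarrow> real"
      assume w [measurable]: "w \<in> borel_measurable \<mu>" and w0: "\<And>x. 0 \<le> w x"
      have "(\<integral>\<^sup>+x. ennreal (exp (birkhoff_sum \<alpha> \<phi> n x) * w ((\<alpha> ^^ n) x)) \<partial>\<mu>)
          \<le> (\<integral>\<^sup>+x. ennreal (exp (c * real n + D)) *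
               ennreal (exp (birkhoff_sum \<alpha> \<psi> n x) * w ((\<alpha> ^^ n) x)) \<partial>\<mu>)"
      proof (rule nn_integral_mono)
        fix x
        have "exp (birkhoff_sum \<alpha> \<phi> n x) \<le> exp (c * real n + D) * exp (birkhoff_sum \<alpha> \<psi> n x)"
          using le[of n x] by (simp flip: exp_add)
        then have "exp (birkhoff_sum \<alpha> \<phi> n x) * w ((\<alpha> ^^ n) x)
            \<le> exp (c * real n + D) * (exp (birkhoff_sum \<alpha> \<psi> n x) * w ((\<alpha> ^^ n) x))"
          using w0 by (metis mult.assoc mult_right_mono)
        then show "ennreal (exp (birkhoff_sum \<alpha> \<phi> n x) * w ((\<alpha> ^^ n) x)) \<le>
            ennreal (exp (c * real n + D)) * ennreal (exp (birkhoff_sum \<alpha> \<psi> n x) * w ((\<alpha> ^^ n) x))"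
          by (simp flip: ennreal_mult' add: ennreal_leI)
      qed
      also have "\<dots> = ennreal (exp (c * real n + D)) *
           (\<integral>\<^sup>+x. ennreal (exp (birkhoff_sum \<alpha> \<psi> n x) * w ((\<alpha> ^^ n) x)) \<partial>\<mu>)"
        by (rule nn_integral_cmult) measurable
      also have "\<dots> \<le> ennreal (exp (c * real n + D)) *
           (ennreal (C * exp (s * real n)) * (\<integral>\<^sup>+x. ennreal (w x) \<partial>\<mu>))"
        using Cle[OF w w0] by (rule mult_left_mono) simp
      also have "\<dots> = ennreal (C * exp D * exp ((s + c) * real n)) * (\<integral>\<^sup>+x. ennreal (w x) \<partial>\<mu>)"
      proof -
        have "C * exp D * exp ((s + c) * real n) = exp (c * real n + D) * (C * exp (s * real n))"
          by (simp add: exp_add algebra_simps)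
        then show ?thesis using C by (simp only: ennreal_mult mult_nonneg_nonneg exp_ge_zero mult.assoc)
      qed
      finally show "(\<integral>\<^sup>+x. ennreal (exp (birkhoff_sum \<alpha> \<phi> n x) * w ((\<alpha> ^^ n) x)) \<partial>\<mu>)
          \<le> ennreal (C * exp D * exp ((s + c) * real n)) * (\<integral>\<^sup>+x. ennreal (w x) \<partial>\<mu>)" .
    qed (use C in simp)
    then have "growth_rate \<mu> \<alpha> \<phi> \<le> s + c"
      unfolding growth_rate_def by (rule cInf_lower[OF _ growth_exponents_bdd_below[OF \<phi>]])
    then show ?thesis by simp
  qed
  then have "growth_rate \<mu> \<alpha> \<phi> - c \<le> growth_rate \<mu> \<alpha> \<psi>"
    unfolding growth_rate_def[of \<mu> \<alpha> \<psi>]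
    using bound_in_growth_exponents[of \<psi>, OF \<psi>] by (intro cInf_greatest) auto
  then show ?thesis by simp
qed

lemma growth_rate_zero: "growth_rate \<mu> \<alpha> (\<lambda>_. 0) = 0"
proof (rule antisym)
  have "0 \<in> growth_exponents \<mu> \<alpha> (\<lambda>_. 0)" by (rule bound_in_growth_exponents) simp
  then show "growth_rate \<mu> \<alpha> (\<lambda>_. 0) \<le> 0" "0 \<le> growth_rate \<mu> \<alpha> (\<lambda>_. 0)"
    unfolding growth_rate_def
    using growth_exponents_ge[of "\<lambda>_. 0" 0] growth_exponents_bdd_below[of "\<lambda>_. 0" 0]
    by (force intro: cInf_lower, force intro!: cInf_greatest)
qed

text \<open>
  A contraction estimate for a single time \<open>N > 0\<close> propagates to all times by submultiplicativity; times below \<open>N\<close>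
  are absorbed by the constant.
\<close>

lemma growth_exponentsI_one_time:
  assumes B: "\<And>x. \<bar>\<psi> x\<bar> \<le> B" and [measurable]: "\<psi> \<in> borel_measurable \<mu>"
    and N: "0 < N"
    and le: "\<And>w. w \<in> borel_measurable \<mu> \<Longrightarrow> (\<And>x. 0 \<le> w x) \<Longrightarrow>
     (\<integral>\<^sup>+x. ennreal (exp (birkhoff_sum \<alpha> \<psi> N x) * w ((\<alpha> ^^ N) x)) \<partial>\<mu>)
       \<le> ennreal (exp (s * real N)) * (\<integral>\<^sup>+x. ennreal (w x) \<partial>\<mu>)"
  shows "s \<in> growth_exponents \<mu> \<alpha> \<psi>"
proof (rule growth_exponentsI)
  define C where "C = exp (real N * (B + \<bar>s\<bar>))"
  show "0 \<le> C" by (simp add: C_def)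
  have B0: "0 \<le> B" using B[of undefined] by linarith
  fix n :: nat and w :: "'a \<Rightarrow> real"
  assume "w \<in> borel_measurable \<mu>" "\<And>x. 0 \<le> w x"
  then show "(\<integral>\<^sup>+x. ennreal (exp (birkhoff_sum \<alpha> \<psi> n x) * w ((\<alpha> ^^ n) x)) \<partial>\<mu>)
       \<le> ennreal (C * exp (s * real n)) * (\<integral>\<^sup>+x. ennreal (w x) \<partial>\<mu>)"
  proof (induction n rule: less_induct)
    case (less n)
    note less.prems(1)[measurable]
    show ?case
    proof (cases "n < N")
      case True
      have "birkhoff_sum \<alpha> \<psi> n x \<le> real N * (B + \<bar>s\<bar>) + s * real n" for x
      proof -
        have "birkhoff_sum \<alpha> \<psi> n x \<le> real n * B"
          using birkhoff_sum_bound[of \<psi> B \<alpha> n x] B by simp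
        also have "\<dots> \<le> real N * B" using True B0 by (simp add: mult_right_mono)
        moreover have "- (s * real n) \<le> \<bar>s\<bar> * real N"
        proof -
          have "- (s * real n) \<le> \<bar>s\<bar> * real n" by (metis abs_ge_minus_self abs_mult abs_of_nat)
          also have "\<dots> \<le> \<bar>s\<bar> * real N" using True by (simp add: mult_left_mono)
          finally show ?thesis .
        qed
        ultimately show ?thesis by (simp add: algebra_simps)
      qed
      from nn_integral_birkhoff_le[OF less.prems this]
      show ?thesis by (simp add: C_def exp_add)
    next
      case False
      define m where "m = n - N"
      have n: "n = N + m" using False by (simp add: m_def)
      have it: "(\<alpha> ^^ n) x = (\<alpha> ^^ m) ((\<alpha> ^^ N) x)" for x
        unfolding n by (subst add.commute) (simp add: funpow_add)
      define v where "v x = exp (birkhoff_sum \<alpha> \<psi> m x) * w ((\<alpha> ^^ m) x)" for x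
      have v [measurable]: "v \<in> borel_measurable \<mu>" unfolding v_def[abs_def] by measurable
      have v0: "0 \<le> v x" for x using less.prems by (simp add: v_def)
      have "(\<integral>\<^sup>+x. ennreal (exp (birkhoff_sum \<alpha> \<psi> n x) * w ((\<alpha> ^^ n) x)) \<partial>\<mu>)
          = (\<integral>\<^sup>+x. ennreal (exp (birkhoff_sum \<alpha> \<psi> N x) * v ((\<alpha> ^^ N) x)) \<partial>\<mu>)"
        unfolding it v_def by (simp add: n birkhoff_sum_add exp_add mult.assoc)
      also have "\<dots> \<le> ennreal (exp (s * real N)) * (\<integral>\<^sup>+x. ennreal (v x) \<partial>\<mu>)"
        using v v0 by (rule le)
      also have "\<dots> \<le> ennreal (exp (s * real N)) *
          (ennreal (C * exp (s * real m)) * (\<integral>\<^sup>+x. ennreal (w x) \<partial>\<mu>))"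
        unfolding v_def using less.IH[of m] less.prems N n by (intro mult_left_mono) auto
      also have "\<dots> = ennreal (C * exp (s * real n)) * (\<integral>\<^sup>+x. ennreal (w x) \<partial>\<mu>)"
      proof -
        have "C * exp (s * real n) = exp (s * real N) * (C * exp (s * real m))"
          by (simp add: n exp_add algebra_simps)
        then show ?thesis
          using \<open>0 \<le> C\<close> by (simp only: ennreal_mult mult_nonneg_nonneg exp_ge_zero mult.assoc)
      qed
      finally show ?thesis .
    qed
  qed
qed

end

section \<open>The spectral radius of a weighted composition operator\<close>

text \<open>
  The \<open>p\<close>-th power of the norm, extended by \<open>\<infinity>\<close> to all measurable functions.  All estimates below are
  made for it, with the crude inequality \<open>(a + b)\<^sup>p \<le> 2\<^sup>p (a\<^sup>p + b\<^sup>p)\<close> in the role of the triangle inequality: constants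
  do not matter for growth rates.
\<close>

definition power_integral :: "'a measure \<Rightarrow> real \<Rightarrow> ('a \<Rightarrow> complex) \<Rightarrow> ennreal" where
  "power_integral \<mu> p u = (\<integral>\<^sup>+x. ennreal (cmod (u x) powr p) \<partial>\<mu>)"

lemma Lp_space_iff:
  "u \<in> Lp_space \<mu> p \<longleftrightarrow> u \<in> borel_measurable \<mu> \<and> power_integral \<mu> p u < \<infinity>"
proof -
  have "(\<lambda>x. cmod (u x) powr p) \<in> borel_measurable \<mu>" if "u \<in> borel_measurable \<mu>"
    using that by measurable
  then show ?thesis
    unfolding Lp_space_def power_integral_def by (auto simp: integrable_iff_bounded)
qed

lemma power_integral_Lp_norm:
  assumes "u \<in> Lp_space \<mu> p" "1 \<le> p"
  shows "power_integral \<mu> p u = ennreal (Lp_norm \<mu> p u powr p)"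
proof -
  have "integrable \<mu> (\<lambda>x. cmod (u x) powr p)" using assms by (simp add: Lp_space_def)
  then have "power_integral \<mu> p u = ennreal (\<integral>x. cmod (u x) powr p \<partial>\<mu>)"
    unfolding power_integral_def by (rule nn_integral_eq_integral) simp
  also have "(\<integral>x. cmod (u x) powr p \<partial>\<mu>) = Lp_norm \<mu> p u powr p"
    unfolding Lp_norm_def using assms(2) by (simp add: powr_powr Bochner_Integration.integral_nonneg)
  finally show ?thesis .
qed

lemma Lp_norm_nonneg: "0 \<le> Lp_norm \<mu> p u"
  by (simp add: Lp_norm_def)

lemma power_integral_leI:
  assumes "u \<in> Lp_space \<mu> p" "v \<in> Lp_space \<mu> p" "1 \<le> p" "0 \<le> K"
    and "Lp_norm \<mu> p v \<le> K * Lp_norm \<mu> p u"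
  shows "power_integral \<mu> p v \<le> ennreal (K powr p) * power_integral \<mu> p u"
proof -
  have "Lp_norm \<mu> p v powr p \<le> (K * Lp_norm \<mu> p u) powr p"
    using assms(3,5) by (intro powr_mono2) (auto simp: Lp_norm_nonneg)
  also have "\<dots> = K powr p * Lp_norm \<mu> p u powr p"
    by (rule powr_mult)
  finally show ?thesis
    using assms(1-3) by (simp add: power_integral_Lp_norm ennreal_mult'[symmetric] ennreal_leI)
qed

lemma Lp_norm_leI:
  assumes "u \<in> Lp_space \<mu> p" "v \<in> Lp_space \<mu> p" "1 \<le> p" "0 \<le> K"
    and "power_integral \<mu> p v \<le> ennreal K * power_integral \<mu> p u"
  shows "Lp_norm \<mu> p v \<le> K powr (1 / p) * Lp_norm \<mu> p u"
proof -
  have "Lp_norm \<mu> p v powr p \<le> K * Lp_norm \<mu> p u powr p"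
    using assms by (simp add: power_integral_Lp_norm ennreal_mult'[symmetric])
  then have "(Lp_norm \<mu> p v powr p) powr (1 / p) \<le> (K * Lp_norm \<mu> p u powr p) powr (1 / p)"
    using assms(3) by (intro powr_mono2) auto
  then show ?thesis
    using assms(3,4) by (simp add: powr_mult powr_powr Lp_norm_nonneg)
qed

lemma power_integral_cong_AE:
  "AE x in \<mu>. u x = v x \<Longrightarrow> power_integral \<mu> p u = power_integral \<mu> p v"
  unfolding power_integral_def by (rule nn_integral_cong_AE) auto

lemma power_integral_cmult:
  assumes [measurable]: "u \<in> borel_measurable \<mu>"
  shows "power_integral \<mu> p (\<lambda>x. c * u x) = ennreal (cmod c powr p) * power_integral \<mu> p u"
  unfolding power_integral_def
  by (subst nn_integral_cmult[symmetric])
     (auto simp: norm_mult powr_mult ennreal_mult'[symmetric] intro!: nn_integral_cong)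

lemma powr_add_le:
  fixes a b p :: real
  assumes "0 \<le> a" "0 \<le> b" "1 \<le> p"
  shows "(a + b) powr p \<le> 2 powr p * (a powr p + b powr p)"
proof -
  have "(a + b) powr p \<le> (2 * max a b) powr p" using assms by (intro powr_mono2) auto
  also have "\<dots> = 2 powr p * max a b powr p" by (rule powr_mult)
  also have "max a b powr p \<le> a powr p + b powr p" using assms by (auto simp: max_def)
  finally show ?thesis by simp
qed

lemma power_integral_add_le:
  assumes [measurable]: "u \<in> borel_measurable \<mu>" "v \<in> borel_measurable \<mu>" and p: "1 \<le> p"
  shows "power_integral \<mu> p (\<lambda>x. u x + v x)
    \<le> ennreal (2 powr p) * (power_integral \<mu> p u + power_integral \<mu> p v)"
proof -
  have "power_integral \<mu> p (\<lambda>x. u x + v x) \<le>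
      (\<integral>\<^sup>+x. ennreal (2 powr p) * (ennreal (cmod (u x) powr p) + ennreal (cmod (v x) powr p)) \<partial>\<mu>)"
    unfolding power_integral_def
  proof (rule nn_integral_mono)
    fix x
    have "cmod (u x + v x) powr p \<le> (cmod (u x) + cmod (v x)) powr p"
      using p by (intro powr_mono2) (auto simp: norm_triangle_ineq)
    also have "\<dots> \<le> 2 powr p * (cmod (u x) powr p + cmod (v x) powr p)"
      using p by (intro powr_add_le) auto
    finally show "ennreal (cmod (u x + v x) powr p) \<le>
        ennreal (2 powr p) * (ennreal (cmod (u x) powr p) + ennreal (cmod (v x) powr p))"
      by (simp add: ennreal_mult'[symmetric] ennreal_plus[symmetric] ennreal_leI del: ennreal_plus)
  qed
  also have "\<dots> = ennreal (2 powr p) * (power_integral \<mu> p u + power_integral \<mu> p v)"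
    unfolding power_integral_def by (simp add: nn_integral_cmult nn_integral_add)
  finally show ?thesis .
qed

lemma ennreal_term_le_suminf:
  fixes f :: "nat \<Rightarrow> ennreal"
  shows "f n \<le> (\<Sum>k. f k)"
  using sum_le_suminf[of f "{n}"] by simp

locale weighted_system = measure_preserving_system \<mu> \<alpha>
  for \<mu> :: "'a measure" and \<alpha> +
  fixes p :: real and \<phi> :: "'a \<Rightarrow> real" and B :: real
  assumes p: "1 \<le> p" and weight_measurable [measurable]: "\<phi> \<in> borel_measurable \<mu>"
    and weight_bounded: "\<And>x. \<bar>\<phi> x\<bar> \<le> B"
begin

abbreviation T :: "('a \<Rightarrow> complex) \<Rightarrow> 'a \<Rightarrow> complex" where
  "T \<equiv> weighted_composition (\<lambda>x. exp (\<phi> x)) \<alpha>"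

abbreviation N :: "('a \<Rightarrow> complex) \<Rightarrow> ennreal" where "N \<equiv> power_integral \<mu> p"

definition iter :: "nat \<Rightarrow> ('a \<Rightarrow> complex) \<Rightarrow> 'a \<Rightarrow> complex" where
  "iter n u x = complex_of_real (exp (birkhoff_sum \<alpha> \<phi> n x)) * u ((\<alpha> ^^ n) x)"

abbreviation \<psi> :: "'a \<Rightarrow> real" where "\<psi> \<equiv> \<lambda>x. p * \<phi> x"

lemma scaled_bounded: "\<bar>p * \<phi> x\<bar> \<le> p * B"
  using weight_bounded p by (simp add: abs_mult mult_left_mono)

lemma birkhoff_scaled: "birkhoff_sum \<alpha> \<psi> n x = p * birkhoff_sum \<alpha> \<phi> n x"
  by (simp add: birkhoff_sum_def sum_distrib_left)

lemma T_eq: "T u x = complex_of_real (exp (\<phi> x)) * u (\<alpha> x)"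
  by (simp add: weighted_composition_def)

lemma iter_0 [simp]: "iter 0 u x = u x"
  by (simp add: iter_def)

lemma iter_Suc: "iter (Suc n) u x = complex_of_real (exp (\<phi> x)) * iter n u (\<alpha> x)"
  by (simp add: iter_def birkhoff_sum_Suc exp_add funpow_swap1)

lemma iter_T: "iter n (T u) x = iter (Suc n) u x"
  using birkhoff_sum_add[of \<alpha> \<phi> n 1 x]
  by (simp add: iter_def weighted_composition_def exp_add birkhoff_sum_def)

lemma iter_add: "iter n (\<lambda>x. u x + v x) x = iter n u x + iter n v x"
  by (simp add: iter_def algebra_simps)

lemma iter_diff: "iter n (\<lambda>x. u x - v x) x = iter n u x - iter n v x"
  by (simp add: iter_def algebra_simps)

lemma iter_cmult: "iter n (\<lambda>x. c * u x) x = c * iter n u x"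
  by (simp add: iter_def)

lemma measurable_iter [measurable (raw)]:
  assumes [measurable]: "u \<in> borel_measurable \<mu>"
  shows "iter n u \<in> borel_measurable \<mu>"
  unfolding iter_def[abs_def] by measurable

lemma T_eq_iter: "T u = iter 1 u"
  by (rule ext) (simp add: iter_Suc weighted_composition_def)

lemma measurable_T [measurable (raw)]:
  "u \<in> borel_measurable \<mu> \<Longrightarrow> T u \<in> borel_measurable \<mu>"
  unfolding T_eq_iter by (rule measurable_iter)

lemma cmod_iter_powr:
  "cmod (iter n u x) powr p = exp (birkhoff_sum \<alpha> \<psi> n x) * cmod (u ((\<alpha> ^^ n) x)) powr p"
  by (simp add: iter_def norm_mult powr_mult birkhoff_scaled exp_powr_real mult.commute)

lemma power_integral_T:
  assumes [measurable]: "u \<in> borel_measurable \<mu>"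
  shows "N (T u) \<le> ennreal (exp (p * B)) * N u"
proof -
  have "birkhoff_sum \<alpha> \<psi> 1 x \<le> p * B" for x
    using scaled_bounded[of x] by (simp add: birkhoff_sum_def)
  then show ?thesis
    unfolding T_eq_iter power_integral_def cmod_iter_powr
    by (intro nn_integral_birkhoff_le) auto
qed

lemma T_in_Lp: "u \<in> Lp_space \<mu> p \<Longrightarrow> T u \<in> Lp_space \<mu> p"
  using power_integral_T[of u] unfolding Lp_space_iff
  by (auto simp: ennreal_mult_less_top intro: order_le_less_trans)

lemma add_in_Lp:
  assumes "u \<in> Lp_space \<mu> p" "v \<in> Lp_space \<mu> p"
  shows "(\<lambda>x. u x + v x) \<in> Lp_space \<mu> p"
proof -
  have [measurable]: "u \<in> borel_measurable \<mu>" "v \<in> borel_measurable \<mu>"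
    using assms by (auto simp: Lp_space_iff)
  have "N (\<lambda>x. u x + v x) < \<infinity>"
    using power_integral_add_le[of u \<mu> v p] assms p unfolding Lp_space_iff
    by (auto simp: ennreal_mult_less_top intro: order_le_less_trans)
  then show ?thesis by (simp add: Lp_space_iff)
qed

lemma cmult_in_Lp:
  assumes "u \<in> Lp_space \<mu> p"
  shows "(\<lambda>x. c * u x) \<in> Lp_space \<mu> p"
  using assms unfolding Lp_space_iff
  by (auto simp: power_integral_cmult ennreal_mult_less_top)

lemma resolvent_in_Lp:
  assumes "u \<in> Lp_space \<mu> p"
  shows "(\<lambda>x. z * u x - T u x) \<in> Lp_space \<mu> p"
proof -
  have "(\<lambda>x. z * u x + (- 1) * T u x) \<in> Lp_space \<mu> p"
    by (intro add_in_Lp cmult_in_Lp T_in_Lp assms)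
  then show ?thesis by simp
qed

section \<open>The Neumann series\<close>

definition neumann :: "complex \<Rightarrow> ('a \<Rightarrow> complex) \<Rightarrow> 'a \<Rightarrow> complex" where
  "neumann z u x = (\<Sum>n. iter n u x / z ^ Suc n)"

definition neumann_converges :: "complex \<Rightarrow> ('a \<Rightarrow> complex) \<Rightarrow> 'a \<Rightarrow> bool" where
  "neumann_converges z u x \<longleftrightarrow> summable (\<lambda>n. iter n u x / z ^ Suc n)"

lemma measurable_neumann [measurable (raw)]:
  "u \<in> borel_measurable \<mu> \<Longrightarrow> neumann z u \<in> borel_measurable \<mu>"
  unfolding neumann_def[abs_def]
  by (intro borel_measurable_suminf borel_measurable_divide measurable_iter borel_measurable_const)

text \<open>
  Convergence at \<open>x\<close> is the same as convergence at \<open>\<alpha>(x)\<close>, up to the factor \<open>e\<^bsup>\<phi>(x)\<^esup>\<close>; therefore the resolvent identities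
  hold at every point of convergence, not just in norm.
\<close>

lemma neumann_shift:
  assumes z: "z \<noteq> 0" and conv: "neumann_converges z u x"
  shows "neumann_converges z (T u) x"
    and "neumann z (T u) x = T (neumann z u) x"
    and "z * neumann z u x - neumann z (T u) x = u x"
proof -
  have s: "summable (\<lambda>n. iter n u x / z ^ Suc n)"
    using conv by (simp add: neumann_converges_def)
  then have s1: "summable (\<lambda>n. iter (Suc n) u x / z ^ Suc (Suc n))"
    using summable_Suc_iff[of "\<lambda>n. iter n u x / z ^ Suc n"] by simp
  have "summable (\<lambda>n. (z / exp (\<phi> x)) * (iter (Suc n) u x / z ^ Suc (Suc n)))"
    using s1 by (rule summable_mult)
  moreover have "(z / exp (\<phi> x)) * (iter (Suc n) u x / z ^ Suc (Suc n)) = iter n u (\<alpha> x) / z ^ Suc n" for n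
    using z by (simp add: iter_Suc exp_of_real)
  ultimately have sa: "summable (\<lambda>n. iter n u (\<alpha> x) / z ^ Suc n)" by simp
  have sT: "iter n (T u) x / z ^ Suc n = complex_of_real (exp (\<phi> x)) * (iter n u (\<alpha> x) / z ^ Suc n)" for n
    by (simp add: iter_T iter_Suc)
  show "neumann_converges z (T u) x"
    unfolding neumann_converges_def sT by (rule summable_mult[OF sa])
  show "neumann z (T u) x = T (neumann z u) x"
    unfolding T_eq[of "neumann z u"] unfolding neumann_def sT by (rule suminf_mult[OF sa])
  have sz: "z * (iter n u x / z ^ Suc n) = iter n u x / z ^ n" for n using z by simp
  have "z * neumann z u x = (\<Sum>n. iter n u x / z ^ n)"
    unfolding neumann_def using suminf_mult[OF s, of z] unfolding sz by simp
  also have "\<dots> = (\<Sum>n. iter (Suc n) u x / z ^ Suc n) + u x"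
    using suminf_split_head[of "\<lambda>n. iter n u x / z ^ n"] summable_mult[OF s, of z] unfolding sz
    by (simp only: iter_0 power_0 div_by_1) simp
  also have "(\<Sum>n. iter (Suc n) u x / z ^ Suc n) = neumann z (T u) x"
    unfolding neumann_def iter_T ..
  finally show "z * neumann z u x - neumann z (T u) x = u x" by simp
qed

lemma neumann_linear:
  assumes "neumann_converges z u x" "neumann_converges z v x"
  shows "neumann z (\<lambda>y. u y + v y) x = neumann z u x + neumann z v x"
    and "neumann z (\<lambda>y. u y - v y) x = neumann z u x - neumann z v x"
    and "neumann z (\<lambda>y. c * u y) x = c * neumann z u x"
    and "neumann_converges z (\<lambda>y. c * u y) x"
  using assms unfolding neumann_def neumann_converges_def iter_add iter_diff iter_cmult
  by (simp_all add: add_divide_distrib diff_divide_distrib suminf_add suminf_diff suminf_mult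
      summable_mult flip: times_divide_eq_right)

text \<open>
  Instead of the triangle inequality in \<open>L\<^sup>p\<close>, the proof compares the series with a geometric
  one: with \<open>q\<close> between \<open>exp(s/p)/|z|\<close> and \<open>1\<close>, the function
  \<open>g = \<Sum>\<^sub>n (|T\<^sup>n u| / (|z| q)\<^sup>n)\<^sup>p\<close> is integrable, and wherever it is finite the terms of the
  series are at most \<open>g\<^bsup>1/p\<^esup> q\<^sup>n / |z|\<close>.
\<close>

lemma neumann_bounded:
  assumes s: "s \<in> growth_exponents \<mu> \<alpha> \<psi>" and z: "exp (s / p) < cmod z"
  obtains K where "0 \<le> K"
    and "\<And>u. u \<in> Lp_space \<mu> p \<Longrightarrow> AE x in \<mu>. neumann_converges z u x"
    and "\<And>u. u \<in> Lp_space \<mu> p \<Longrightarrow> N (neumann z u) \<le> ennreal K * N u"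
proof -
  obtain C where C: "0 \<le> C" and Cle: "\<And>n w. w \<in> borel_measurable \<mu> \<Longrightarrow> (\<And>x. 0 \<le> w x) \<Longrightarrow>
     (\<integral>\<^sup>+x. ennreal (exp (birkhoff_sum \<alpha> \<psi> n x) * w ((\<alpha> ^^ n) x)) \<partial>\<mu>)
       \<le> ennreal (C * exp (s * real n)) * (\<integral>\<^sup>+x. ennreal (w x) \<partial>\<mu>)"
    using growth_exponentsE[OF s] by metis
  define r where "r = cmod z"
  have r: "0 < r" using z exp_gt_zero[of "s / p"] unfolding r_def by linarith
  obtain R where R: "exp (s / p) < R" "R < r" using z dense unfolding r_def by blast
  have R0: "0 < R" using R(1) exp_gt_zero[of "s / p"] by linarith
  define q where "q = R / r"
  have q: "0 < q" "q < 1" using R R0 r by (simp_all add: q_def)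
  define \<rho> where "\<rho> = exp s / R powr p"
  have "exp s = exp (s / p) powr p" using p by (simp add: exp_powr_real)
  also have "\<dots> < R powr p" using R p by (intro powr_less_mono2) auto
  finally have \<rho>: "0 < \<rho>" "\<rho> < 1" using R0 by (simp_all add: \<rho>_def)
  have Rp: "(R ^ n) powr p = (R powr p) ^ n" for n
    using R0 by (simp add: powr_powr powr_realpow[symmetric] mult.commute)
  define g where "g u x = (\<Sum>n. ennreal ((cmod (iter n u x) / R ^ n) powr p))" for u x
  have g_measurable [measurable]: "g u \<in> borel_measurable \<mu>" if [measurable]: "u \<in> borel_measurable \<mu>" for u
    unfolding g_def[abs_def] by measurable
  have g_le: "(\<integral>\<^sup>+x. g u x \<partial>\<mu>) \<le> ennreal (C / (1 - \<rho>)) * N u"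
    if [measurable]: "u \<in> borel_measurable \<mu>" for u
  proof -
    have "(\<integral>\<^sup>+x. g u x \<partial>\<mu>) = (\<Sum>n. \<integral>\<^sup>+x. ennreal ((cmod (iter n u x) / R ^ n) powr p) \<partial>\<mu>)"
      unfolding g_def by (rule nn_integral_suminf) measurable
    also have "\<dots> \<le> (\<Sum>n. ennreal (C * \<rho> ^ n) * N u)"
    proof (intro suminf_le allI)
      fix n
      have "(\<integral>\<^sup>+x. ennreal ((cmod (iter n u x) / R ^ n) powr p) \<partial>\<mu>)
          = (\<integral>\<^sup>+x. ennreal (1 / (R powr p) ^ n) * ennreal (exp (birkhoff_sum \<alpha> \<psi> n x) * cmod (u ((\<alpha> ^^ n) x)) powr p) \<partial>\<mu>)"
        using R0 by (intro nn_integral_cong)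
          (simp add: powr_divide Rp cmod_iter_powr ennreal_mult'[symmetric])
      also have "\<dots> = ennreal (1 / (R powr p) ^ n) *
          (\<integral>\<^sup>+x. ennreal (exp (birkhoff_sum \<alpha> \<psi> n x) * cmod (u ((\<alpha> ^^ n) x)) powr p) \<partial>\<mu>)"
        by (rule nn_integral_cmult) measurable
      also have "\<dots> \<le> ennreal (1 / (R powr p) ^ n) * (ennreal (C * exp (s * real n)) * N u)"
        unfolding power_integral_def
        by (intro mult_left_mono Cle[of "\<lambda>x. cmod (u x) powr p"]) auto
      also have "\<dots> = ennreal (1 / (R powr p) ^ n * (C * exp (s * real n))) * N u"
        using C by (subst ennreal_mult) (auto simp: mult.assoc)
      also have "1 / (R powr p) ^ n * (C * exp (s * real n)) = C * \<rho> ^ n"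
        by (simp add: \<rho>_def power_divide exp_of_nat_mult[symmetric] mult.commute)
      finally show "(\<integral>\<^sup>+x. ennreal ((cmod (iter n u x) / R ^ n) powr p) \<partial>\<mu>) \<le> ennreal (C * \<rho> ^ n) * N u" .
    qed auto
    also have "\<dots> = (\<Sum>n. ennreal (C * \<rho> ^ n)) * N u" by simp
    also have "(\<Sum>n. ennreal (C * \<rho> ^ n)) = ennreal (C / (1 - \<rho>))"
    proof (rule suminf_ennreal_eq)
      show "(\<lambda>n. C * \<rho> ^ n) sums (C / (1 - \<rho>))"
        using sums_mult[OF geometric_sums[of \<rho>], of C] \<rho> by simp
    qed (use C \<rho> in auto)
    finally show ?thesis .
  qed
  have pointwise: "neumann_converges z u x \<and>
      ennreal (cmod (neumann z u x) powr p) \<le> ennreal ((1 / (r * (1 - q))) powr p) * g u x"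
    if fin: "g u x < \<infinity>" for u x
  proof -
    define G where "G = enn2real (g u x)"
    have G: "g u x = ennreal G" "0 \<le> G" using fin by (simp_all add: G_def)
    have term_le: "cmod (iter n u x) / R ^ n \<le> G powr (1 / p)" for n
    proof -
      have "ennreal ((cmod (iter n u x) / R ^ n) powr p) \<le> g u x"
        unfolding g_def by (rule ennreal_term_le_suminf)
      then have "(cmod (iter n u x) / R ^ n) powr p \<le> G"
        unfolding G(1) by (simp only: ennreal_le_iff[OF G(2)])
      then have "((cmod (iter n u x) / R ^ n) powr p) powr (1 / p) \<le> G powr (1 / p)"
        using p by (intro powr_mono2) auto
      then show ?thesis using p R0 by (simp add: powr_powr)
    qed
    have bound: "cmod (iter n u x / z ^ Suc n) \<le> (G powr (1 / p) / r) * q ^ n" for n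
    proof -
      have "cmod (iter n u x / z ^ Suc n) = (cmod (iter n u x) / R ^ n) * (q ^ n / r)"
        using R0 by (simp add: norm_divide norm_mult norm_power q_def power_divide r_def)
      also have "\<dots> \<le> G powr (1 / p) * (q ^ n / r)"
        using term_le q r by (intro mult_right_mono) auto
      finally show ?thesis by simp
    qed
    have geo: "(\<lambda>n. (G powr (1 / p) / r) * q ^ n) sums ((G powr (1 / p) / r) * (1 / (1 - q)))"
      using q by (intro sums_mult geometric_sums) simp
    have conv: "summable (\<lambda>n. cmod (iter n u x / z ^ Suc n))"
      using bound by (intro summable_comparison_test[OF _ sums_summable[OF geo]]) auto
    have "cmod (neumann z u x) \<le> (\<Sum>n. cmod (iter n u x / z ^ Suc n))"
      unfolding neumann_def by (rule summable_norm[OF conv])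
    also have "\<dots> \<le> (\<Sum>n. (G powr (1 / p) / r) * q ^ n)"
      using bound by (intro suminf_le conv sums_summable[OF geo])
    also have "\<dots> = 1 / (r * (1 - q)) * G powr (1 / p)"
      using sums_unique[OF geo] by simp
    finally have "cmod (neumann z u x) powr p \<le> (1 / (r * (1 - q)) * G powr (1 / p)) powr p"
      using p by (intro powr_mono2) auto
    also have "\<dots> = (1 / (r * (1 - q))) powr p * G"
      using p G(2) by (subst powr_mult) (simp add: powr_powr)
    finally show ?thesis
      using summable_norm_cancel[OF conv] G
      by (simp add: neumann_converges_def ennreal_mult'[symmetric] ennreal_leI)
  qed
  define K where "K = (1 / (r * (1 - q))) powr p * (C / (1 - \<rho>))"
  have finite: "AE x in \<mu>. g u x < \<infinity>" if u: "u \<in> Lp_space \<mu> p" for u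
  proof -
    have [measurable]: "u \<in> borel_measurable \<mu>" and fin: "N u < \<infinity>" using u by (auto simp: Lp_space_iff)
    have "(\<integral>\<^sup>+x. g u x \<partial>\<mu>) < \<infinity>"
      using g_le[of u] fin by (auto simp: ennreal_mult_less_top intro: order_le_less_trans)
    then have "AE x in \<mu>. g u x \<noteq> \<infinity>" by (intro nn_integral_PInf_AE) auto
    then show ?thesis by (auto simp: less_top)
  qed
  show thesis
  proof (rule that[of K])
    show "0 \<le> K" using C \<rho> by (simp add: K_def)
    fix u assume u: "u \<in> Lp_space \<mu> p"
    then have [measurable]: "u \<in> borel_measurable \<mu>" by (simp add: Lp_space_iff)
    show "AE x in \<mu>. neumann_converges z u x"
      using finite[OF u] by eventually_elim (use pointwise in blast)
    have "N (neumann z u) \<le> (\<integral>\<^sup>+x. ennreal ((1 / (r * (1 - q))) powr p) * g u x \<partial>\<mu>)"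
      unfolding power_integral_def
      by (rule nn_integral_mono_AE) (use finite[OF u] in \<open>eventually_elim, use pointwise in blast\<close>)
    also have "\<dots> = ennreal ((1 / (r * (1 - q))) powr p) * (\<integral>\<^sup>+x. g u x \<partial>\<mu>)"
      by (rule nn_integral_cmult) measurable
    also have "\<dots> \<le> ennreal ((1 / (r * (1 - q))) powr p) * (ennreal (C / (1 - \<rho>)) * N u)"
      by (intro mult_left_mono g_le) auto
    also have "\<dots> = ennreal K * N u"
      unfolding K_def using C \<rho> by (subst ennreal_mult) (auto simp: mult.assoc)
    finally show "N (neumann z u) \<le> ennreal K * N u" .
  qed
qed

text \<open>
  Outside the disc the Neumann series is a bounded two-sided inverse.
\<close>

lemma not_in_spectrum:
  assumes "exp (growth_rate \<mu> \<alpha> \<psi> / p) < cmod z"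
  shows "z \<notin> Lp_spectrum \<mu> p T"
proof -
  have z0: "0 < cmod z" using assms exp_gt_zero[of "growth_rate \<mu> \<alpha> \<psi> / p"] by linarith
  then have z: "z \<noteq> 0" by simp
  have "growth_rate \<mu> \<alpha> \<psi> / p < ln (cmod z)" using assms z0 by (metis exp_less_cancel_iff exp_ln)
  then have "growth_rate \<mu> \<alpha> \<psi> < p * ln (cmod z)" using p by (simp add: field_simps)
  then obtain s where s: "s \<in> growth_exponents \<mu> \<alpha> \<psi>" "s < p * ln (cmod z)"
    using growth_exponents_above[of \<psi> "p * B"] scaled_bounded by blast
  then have "s / p < ln (cmod z)" using p by (simp add: field_simps)
  then have "exp (s / p) < cmod z" using z0 by (metis exp_less_cancel_iff exp_ln)
  then obtain K where K: "0 \<le> K" "\<And>u. u \<in> Lp_space \<mu> p \<Longrightarrow> AE x in \<mu>. neumann_converges z u x"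
      "\<And>u. u \<in> Lp_space \<mu> p \<Longrightarrow> N (neumann z u) \<le> ennreal K * N u"
    using neumann_bounded[OF s(1)] by metis
  have Lp: "neumann z u \<in> Lp_space \<mu> p" if "u \<in> Lp_space \<mu> p" for u
    using that K(3)[OF that] unfolding Lp_space_iff
    by (auto simp: ennreal_mult_less_top intro: order_le_less_trans measurable_neumann)
  have "Lp_operator \<mu> p (neumann z)"
    unfolding Lp_operator_def
  proof (intro conjI ballI allI)
    show "neumann z u \<in> Lp_space \<mu> p" if "u \<in> Lp_space \<mu> p" for u by (rule Lp[OF that])
    show "AE x in \<mu>. neumann z (\<lambda>y. u y + v y) x = neumann z u x + neumann z v x"
      if "u \<in> Lp_space \<mu> p" "v \<in> Lp_space \<mu> p" for u v
      using K(2)[OF that(1)] K(2)[OF that(2)] by eventually_elim (rule neumann_linear)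
    show "AE x in \<mu>. neumann z (\<lambda>y. c * u y) x = c * neumann z u x"
      if "u \<in> Lp_space \<mu> p" for c u
      using K(2)[OF that] by eventually_elim (rule neumann_linear)
    show "\<exists>K. \<forall>u\<in>Lp_space \<mu> p. Lp_norm \<mu> p (neumann z u) \<le> K * Lp_norm \<mu> p u"
      using Lp_norm_leI[OF _ Lp p K(1) K(3)] by blast
  qed
  moreover have "AE x in \<mu>. neumann z (\<lambda>y. z * u y - T u y) x = u x"
    and "AE x in \<mu>. z * neumann z u x - T (neumann z u) x = u x"
    if u: "u \<in> Lp_space \<mu> p" for u
  proof -
    show "AE x in \<mu>. neumann z (\<lambda>y. z * u y - T u y) x = u x"
      using K(2)[OF u]
    proof eventually_elim
      case (elim x)
      note sh = neumann_shift[OF z elim]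
      show ?case
        using neumann_linear(2)[OF neumann_linear(4)[OF elim elim, of z] sh(1)]
          neumann_linear(3)[OF elim elim, of z] sh(3) by simp
    qed
    show "AE x in \<mu>. z * neumann z u x - T (neumann z u) x = u x"
      using K(2)[OF u] by eventually_elim (use neumann_shift[OF z] in metis)
  qed
  ultimately show ?thesis unfolding Lp_spectrum_def by blast
qed

section \<open>The growth rate lies in the spectrum\<close>

text \<open>
  The left-inverse property and the boundedness of the resolvent, combined into an estimate without representatives.
\<close>

lemma bounded_below_off_spectrum:
  assumes "z \<notin> Lp_spectrum \<mu> p T"
  obtains \<kappa> where "0 < \<kappa>"
    and "\<And>v. v \<in> Lp_space \<mu> p \<Longrightarrow> N v \<le> ennreal \<kappa> * N (\<lambda>x. z * v x - T v x)"
proof -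
  obtain R where R: "Lp_operator \<mu> p R"
      "\<And>v. v \<in> Lp_space \<mu> p \<Longrightarrow> AE x in \<mu>. R (\<lambda>y. z * v y - T v y) x = v x"
    using assms unfolding Lp_spectrum_def by blast
  obtain K0 where K0: "\<And>f. f \<in> Lp_space \<mu> p \<Longrightarrow> Lp_norm \<mu> p (R f) \<le> K0 * Lp_norm \<mu> p f"
    using R(1) unfolding Lp_operator_def by blast
  define K where "K = max K0 1"
  have K: "0 < K" by (simp add: K_def)
  have "Lp_norm \<mu> p (R f) \<le> K * Lp_norm \<mu> p f" if "f \<in> Lp_space \<mu> p" for f
    using K0[OF that] by (rule order_trans) (simp add: K_def mult_right_mono Lp_norm_nonneg)
  then have le: "N (R f) \<le> ennreal (K powr p) * N f" if "f \<in> Lp_space \<mu> p" for f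
    using that R(1) p K unfolding Lp_operator_def by (intro power_integral_leI) auto
  show thesis
  proof (rule that[of "K powr p"])
    fix v assume v: "v \<in> Lp_space \<mu> p"
    have "N v = N (R (\<lambda>y. z * v y - T v y))"
      using R(2)[OF v] by (intro power_integral_cong_AE) (auto elim: eventually_mono)
    then show "N v \<le> ennreal (K powr p) * N (\<lambda>x. z * v x - T v x)"
      using le[OF resolvent_in_Lp[OF v]] by simp
  qed (use K in simp)
qed

definition pos_iter :: "nat \<Rightarrow> ('a \<Rightarrow> real) \<Rightarrow> 'a \<Rightarrow> real" where
  "pos_iter n u x = exp (birkhoff_sum \<alpha> \<phi> n x) * u ((\<alpha> ^^ n) x)"

definition z0 :: real where "z0 = exp (growth_rate \<mu> \<alpha> \<psi> / p)"

definition partial_sum :: "nat \<Rightarrow> ('a \<Rightarrow> real) \<Rightarrow> 'a \<Rightarrow> real" where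
  "partial_sum M u x = (\<Sum>n<M. pos_iter n u x / z0 ^ n)"

lemma z0_pos: "0 < z0" by (simp add: z0_def)

lemma measurable_pos_iter [measurable (raw)]:
  assumes [measurable]: "u \<in> borel_measurable \<mu>"
  shows "pos_iter n u \<in> borel_measurable \<mu>"
  unfolding pos_iter_def[abs_def] by measurable

lemma measurable_partial_sum [measurable (raw)]:
  assumes [measurable]: "u \<in> borel_measurable \<mu>"
  shows "partial_sum n u \<in> borel_measurable \<mu>"
  unfolding partial_sum_def[abs_def] by measurable

lemma pos_iter_nonneg: "(\<And>x. 0 \<le> u x) \<Longrightarrow> 0 \<le> pos_iter n u x"
  by (simp add: pos_iter_def)

lemma partial_sum_nonneg: "(\<And>x. 0 \<le> u x) \<Longrightarrow> 0 \<le> partial_sum n u x"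
  unfolding partial_sum_def using z0_pos by (intro sum_nonneg) (simp add: pos_iter_nonneg)

lemma iter_of_real: "iter n (\<lambda>x. complex_of_real (u x)) x = complex_of_real (pos_iter n u x)"
  by (simp add: iter_def pos_iter_def)

text \<open>
  If \<open>z0\<close> is a regular value, the lower bound for \<open>z0 - T\<close> persists nearby.  For \<open>v = (r - T)\<^sup>-\<^sup>1 u\<close> one has
  \<open>(z0 - T) v = u - (r - z0) v\<close>, and for \<open>r\<close> close to \<open>z0\<close> the last term is absorbed on the left.
\<close>

lemma neumann_uniformly_bounded:
  assumes "complex_of_real z0 \<notin> Lp_spectrum \<mu> p T"
  obtains \<delta> K where "0 < \<delta>" "0 < K"
    and "\<And>r u. z0 < r \<Longrightarrow> r < z0 + \<delta> \<Longrightarrow> u \<in> Lp_space \<mu> p \<Longrightarrow>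
      (AE x in \<mu>. neumann_converges (complex_of_real r) u x) \<and>
      N (neumann (complex_of_real r) u) \<le> ennreal K * N u"
proof -
  obtain \<kappa> where \<kappa>: "0 < \<kappa>"
      "\<And>v. v \<in> Lp_space \<mu> p \<Longrightarrow> N v \<le> ennreal \<kappa> * N (\<lambda>x. complex_of_real z0 * v x - T v x)"
    using bounded_below_off_spectrum[OF assms] by metis
  define \<delta> where "\<delta> = (1 / (2 * \<kappa> * 2 powr p)) powr (1 / p)"
  have \<delta>: "0 < \<delta>" using \<kappa>(1) by (simp add: \<delta>_def)
  have \<delta>p: "\<kappa> * 2 powr p * \<delta> powr p = 1 / 2"
    using \<kappa>(1) p by (simp add: \<delta>_def powr_powr)
  show thesis
  proof (rule that[OF \<delta>, of "2 * \<kappa> * 2 powr p"])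
    show "0 < 2 * \<kappa> * 2 powr p" using \<kappa>(1) by simp
    fix r u assume r: "z0 < r" "r < z0 + \<delta>" and u: "u \<in> Lp_space \<mu> p"
    have r0: "0 < r" using r(1) z0_pos by linarith
    have "ln z0 < ln r" using r z0_pos by simp
    then have "growth_rate \<mu> \<alpha> \<psi> < p * ln r" using p by (simp add: z0_def field_simps)
    then obtain s where s: "s \<in> growth_exponents \<mu> \<alpha> \<psi>" "s < p * ln r"
      using growth_exponents_above[of \<psi> "p * B"] scaled_bounded by blast
    then have "s / p < ln r" using p by (simp add: field_simps)
    then have "exp (s / p) < cmod (complex_of_real r)"
      using r0 by (metis exp_less_cancel_iff exp_ln norm_of_real abs_of_pos)
    then obtain K where K: "0 \<le> K"
        "\<And>u. u \<in> Lp_space \<mu> p \<Longrightarrow> AE x in \<mu>. neumann_converges (complex_of_real r) u x"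
        "\<And>u. u \<in> Lp_space \<mu> p \<Longrightarrow> N (neumann (complex_of_real r) u) \<le> ennreal K * N u"
      using neumann_bounded[OF s(1)] by metis
    define v where "v = neumann (complex_of_real r) u"
    have um [measurable]: "u \<in> borel_measurable \<mu>" and ufin: "N u < \<infinity>"
      using u by (auto simp: Lp_space_iff)
    have vm [measurable]: "v \<in> borel_measurable \<mu>"
      unfolding v_def by (rule measurable_neumann[OF um])
    have vfin: "N v < \<infinity>"
      using K(3)[OF u] ufin unfolding v_def
      by (auto simp: ennreal_mult_less_top intro: order_le_less_trans)
    have v: "v \<in> Lp_space \<mu> p" using vfin by (simp add: Lp_space_iff)
    have "AE x in \<mu>. complex_of_real z0 * v x - T v x = u x + complex_of_real (z0 - r) * v x"
      using K(2)[OF u]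
    proof eventually_elim
      case (elim x)
      have "complex_of_real r * v x - T v x = u x"
        using neumann_shift(2,3)[OF _ elim] r0 unfolding v_def by simp
      then show ?case by (simp add: algebra_simps)
    qed
    then have "N (\<lambda>x. complex_of_real z0 * v x - T v x) = N (\<lambda>x. u x + complex_of_real (z0 - r) * v x)"
      by (rule power_integral_cong_AE)
    also have "\<dots> \<le> ennreal (2 powr p) * (N u + N (\<lambda>x. complex_of_real (z0 - r) * v x))"
      using p by (intro power_integral_add_le) measurable
    also have "N (\<lambda>x. complex_of_real (z0 - r) * v x) = ennreal ((r - z0) powr p) * N v"
      using power_integral_cmult[OF vm, of p "complex_of_real (z0 - r)"] r(1)
      unfolding norm_of_real by simp
    finally have "N v \<le> ennreal \<kappa> * (ennreal (2 powr p) * (N u + ennreal ((r - z0) powr p) * N v))"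
      using \<kappa>(2)[OF v] mult_left_mono by (meson order_trans zero_le)
    moreover obtain a b where ab: "N u = ennreal a" "0 \<le> a" "N v = ennreal b" "0 \<le> b"
      using ufin vfin by (metis ennreal_cases less_irrefl infinity_ennreal_def)
    ultimately have "ennreal b \<le> ennreal (\<kappa> * (2 powr p * (a + (r - z0) powr p * b)))"
      using \<kappa>(1) by (simp add: ennreal_mult'[symmetric] ennreal_plus[symmetric] del: ennreal_plus)
    then have "b \<le> \<kappa> * (2 powr p * (a + (r - z0) powr p * b))"
      using \<kappa>(1) ab by (subst (asm) ennreal_le_iff) auto
    also have "\<dots> \<le> \<kappa> * (2 powr p * (a + \<delta> powr p * b))"
      using r p ab \<kappa>(1) by (intro mult_left_mono add_left_mono mult_right_mono powr_mono2) auto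
    also have "\<dots> = \<kappa> * 2 powr p * a + (\<kappa> * 2 powr p * \<delta> powr p) * b"
      by (simp add: algebra_simps)
    finally have "b \<le> 2 * \<kappa> * 2 powr p * a" unfolding \<delta>p by simp
    then have "N v \<le> ennreal (2 * \<kappa> * 2 powr p) * N u"
      using ab \<kappa>(1) by (simp add: ennreal_mult'[symmetric] ennreal_leI)
    then show "(AE x in \<mu>. neumann_converges (complex_of_real r) u x) \<and>
        N (neumann (complex_of_real r) u) \<le> ennreal (2 * \<kappa> * 2 powr p) * N u"
      using K(2)[OF u] unfolding v_def by blast
  qed
qed

text \<open>
  For nonnegative \<open>u\<close> the partial sums of the Neumann series at \<open>r > z0\<close> are below its limit, so they inherit a bound that
  is independent of \<open>r\<close> and of their length.  For fixed length, \<open>r\<close> may be moved to \<open>z0\<close> at the cost of a factor \<open>2\<close>.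
\<close>

lemma partial_sums_bounded:
  assumes "complex_of_real z0 \<notin> Lp_spectrum \<mu> p T"
  obtains K where "0 < K"
    and "\<And>M u. u \<in> borel_measurable \<mu> \<Longrightarrow> (\<And>x. 0 \<le> u x) \<Longrightarrow>
      (\<integral>\<^sup>+x. ennreal (u x powr p) \<partial>\<mu>) < \<infinity> \<Longrightarrow>
      (\<integral>\<^sup>+x. ennreal (partial_sum M u x powr p) \<partial>\<mu>) \<le> ennreal K * (\<integral>\<^sup>+x. ennreal (u x powr p) \<partial>\<mu>)"
proof -
  obtain \<delta> K where \<delta>: "0 < \<delta>" and K: "0 < K"
    and unif: "\<And>r u. z0 < r \<Longrightarrow> r < z0 + \<delta> \<Longrightarrow> u \<in> Lp_space \<mu> p \<Longrightarrow>
      (AE x in \<mu>. neumann_converges (complex_of_real r) u x) \<and>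
      N (neumann (complex_of_real r) u) \<le> ennreal K * N u"
    using neumann_uniformly_bounded[OF assms] by metis
  define D where "D = 2 * (z0 + \<delta>)"
  have D: "0 < D" using \<delta> z0_pos by (simp add: D_def)
  show thesis
  proof (rule that[of "D powr p * K"])
    show "0 < D powr p * K" using D K by simp
    fix M :: nat and u :: "'a \<Rightarrow> real"
    assume um [measurable]: "u \<in> borel_measurable \<mu>" and u0: "\<And>x. 0 \<le> u x"
      and fin: "(\<integral>\<^sup>+x. ennreal (u x powr p) \<partial>\<mu>) < \<infinity>"
    define U where "U x = complex_of_real (u x)" for x
    have Um [measurable]: "U \<in> borel_measurable \<mu>" unfolding U_def[abs_def] by measurable
    have NU: "N U = (\<integral>\<^sup>+x. ennreal (u x powr p) \<partial>\<mu>)"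
      using u0 by (simp add: power_integral_def U_def)
    have U: "U \<in> Lp_space \<mu> p" using fin NU by (simp add: Lp_space_iff)
    \<comment> \<open>With \<open>r \<le> t z0\<close> all the ratios \<open>(r/z0)\<^sup>n\<close>, \<open>n < M\<close>, are at most \<open>2\<close>.\<close>
    define t where "t = 2 powr (1 / real (Suc M))"
    have t: "1 < t" by (simp add: t_def)
    have "t ^ M \<le> t ^ Suc M" using t by (intro power_increasing) auto
    also have "t ^ Suc M = 2" by (simp add: t_def powr_realpow[symmetric] powr_powr del: power_Suc)
    finally have tM: "t ^ M \<le> 2" .
    define r where "r = min (z0 + \<delta> / 2) (z0 * t)"
    have r: "z0 < r" "r < z0 + \<delta>" "r \<le> z0 * t"
      using \<delta> t z0_pos by (auto simp: r_def min_def)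
    have r0: "0 < r" using r(1) z0_pos by linarith
    have coeff: "1 / z0 ^ n \<le> D * (1 / r ^ Suc n)" if n: "n < M" for n
    proof -
      have "(r / z0) ^ n \<le> t ^ n"
        using r(3) r0 z0_pos by (intro power_mono) (auto simp: field_simps)
      also have "\<dots> \<le> t ^ M" using t n by (intro power_increasing) auto
      finally have "(r / z0) ^ n \<le> 2" using tM by linarith
      then have "r ^ n \<le> 2 * z0 ^ n" using z0_pos by (simp add: power_divide field_simps)
      then have "r ^ n * r \<le> (2 * z0 ^ n) * (z0 + \<delta>)"
        using r(2) r0 z0_pos by (intro mult_mono) auto
      then show ?thesis using r0 z0_pos by (simp add: D_def field_simps)
    qed
    have "AE x in \<mu>. partial_sum M u x \<le> cmod (D * neumann r U x)"
      using conjunct1[OF unif[OF r(1,2) U]]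
    proof eventually_elim
      case (elim x)
      then have s: "summable (\<lambda>n. iter n U x / complex_of_real r ^ Suc n)"
        by (simp add: neumann_converges_def)
      have re: "Re (iter n U x / complex_of_real r ^ Suc n) = pos_iter n u x / r ^ Suc n" for n
      proof -
        have "iter n U x / complex_of_real r ^ Suc n = complex_of_real (pos_iter n u x / r ^ Suc n)"
          unfolding U_def iter_of_real by simp
        then show ?thesis by (metis Re_complex_of_real)
      qed
      have "partial_sum M u x \<le> (\<Sum>n<M. D * (pos_iter n u x / r ^ Suc n))"
        unfolding partial_sum_def
      proof (rule sum_mono)
        fix n assume "n \<in> {..<M}"
        then have "pos_iter n u x * (1 / z0 ^ n) \<le> pos_iter n u x * (D * (1 / r ^ Suc n))"
          using coeff by (intro mult_left_mono pos_iter_nonneg u0) auto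
        then show "pos_iter n u x / z0 ^ n \<le> D * (pos_iter n u x / r ^ Suc n)"
          by (simp add: mult.commute mult.left_commute)
      qed
      also have "\<dots> = D * (\<Sum>n<M. pos_iter n u x / r ^ Suc n)" by (simp only: sum_distrib_left)
      also have "(\<Sum>n<M. pos_iter n u x / r ^ Suc n) \<le> (\<Sum>n. pos_iter n u x / r ^ Suc n)"
        using summable_Re[OF s] r0 unfolding re
        by (intro sum_le_suminf) (auto simp: pos_iter_nonneg u0)
      also have "(\<Sum>n. pos_iter n u x / r ^ Suc n) = Re (neumann r U x)"
        unfolding neumann_def bounded_linear.suminf[OF bounded_linear_Re s] re ..
      also have "Re (neumann r U x) \<le> cmod (neumann r U x)" by (rule complex_Re_le_cmod)
      finally show ?case using D by (simp add: norm_mult)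
    qed
    then have "(\<integral>\<^sup>+x. ennreal (partial_sum M u x powr p) \<partial>\<mu>) \<le> N (\<lambda>x. complex_of_real D * neumann r U x)"
      unfolding power_integral_def using p
      by (intro nn_integral_mono_AE) (auto elim!: eventually_mono intro!: ennreal_leI powr_mono2 partial_sum_nonneg u0)
    also have "\<dots> = ennreal (D powr p) * N (neumann r U)"
      using power_integral_cmult[OF measurable_neumann[OF Um], of p "complex_of_real D"] D by simp
    also have "\<dots> \<le> ennreal (D powr p) * (ennreal K * N U)"
      using unif[OF r(1,2) U] by (intro mult_left_mono) auto
    also have "\<dots> = ennreal (D powr p * K) * N U"
      using K by (subst ennreal_mult) (auto simp: mult.assoc)
    finally show "(\<integral>\<^sup>+x. ennreal (partial_sum M u x powr p) \<partial>\<mu>) \<le>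
        ennreal (D powr p * K) * (\<integral>\<^sup>+x. ennreal (u x powr p) \<partial>\<mu>)"
      unfolding NU .
  qed
qed

text \<open>
  In the square of \<open>1 + A + \<dots> + A\<^sup>m\<close> the power \<open>A\<^sup>m\<close> occurs \<open>m + 1\<close> times, and all other terms are nonnegative.
\<close>

lemma partial_sum_twice_ge:
  assumes "\<And>x. 0 \<le> u x"
  shows "real (Suc m) * (pos_iter m u x / z0 ^ m) \<le> partial_sum (Suc m) (partial_sum (Suc m) u) x"
proof -
  have "pos_iter m u x / z0 ^ m \<le> pos_iter n (partial_sum (Suc m) u) x / z0 ^ n" if n: "n \<le> m" for n
  proof -
    define k where "k = m - n"
    have m: "m = n + k" using n by (simp add: k_def)
    have it: "(\<alpha> ^^ m) x = (\<alpha> ^^ k) ((\<alpha> ^^ n) x)"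
      unfolding m by (subst add.commute) (simp add: funpow_add)
    let ?y = "(\<alpha> ^^ n) x"
    have "pos_iter k u ?y / z0 ^ k \<le> partial_sum (Suc m) u ?y"
      unfolding partial_sum_def using z0_pos assms
      by (intro member_le_sum) (auto simp: m pos_iter_nonneg)
    then have "exp (birkhoff_sum \<alpha> \<phi> n x) * (pos_iter k u ?y / z0 ^ k) / z0 ^ n
        \<le> exp (birkhoff_sum \<alpha> \<phi> n x) * partial_sum (Suc m) u ?y / z0 ^ n"
      using z0_pos by (intro divide_right_mono mult_left_mono) auto
    moreover have "exp (birkhoff_sum \<alpha> \<phi> n x) * (pos_iter k u ?y / z0 ^ k) / z0 ^ n = pos_iter m u x / z0 ^ m"
      unfolding pos_iter_def it unfolding m by (simp only: birkhoff_sum_add exp_add power_add) (simp add: ac_simps)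
    ultimately show ?thesis by (simp add: pos_iter_def[of n])
  qed
  then have "(\<Sum>n<Suc m. pos_iter m u x / z0 ^ m) \<le> (\<Sum>n<Suc m. pos_iter n (partial_sum (Suc m) u) x / z0 ^ n)"
    by (intro sum_mono) auto
  then show ?thesis unfolding partial_sum_def[of "Suc m" "partial_sum (Suc m) u"] by simp
qed

text \<open>
  Otherwise the partial sums \<open>1 + A + \<dots> + A\<^sup>m\<close> with \<open>A = T / z0\<close> are bounded on the positive cone uniformly in \<open>m\<close>.
  Applying them twice bounds \<open>(m + 1) A\<^sup>m\<close>, so some power of \<open>A\<close> is a strict contraction,
  and the growth rate would be smaller than it is.
\<close>

lemma growth_rate_in_spectrum: "complex_of_real z0 \<in> Lp_spectrum \<mu> p T"
proof (rule ccontr)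
  assume "complex_of_real z0 \<notin> Lp_spectrum \<mu> p T"
  then obtain K where K: "0 < K"
    and bound: "\<And>M u. u \<in> borel_measurable \<mu> \<Longrightarrow> (\<And>x. 0 \<le> u x) \<Longrightarrow>
      (\<integral>\<^sup>+x. ennreal (u x powr p) \<partial>\<mu>) < \<infinity> \<Longrightarrow>
      (\<integral>\<^sup>+x. ennreal (partial_sum M u x powr p) \<partial>\<mu>) \<le> ennreal K * (\<integral>\<^sup>+x. ennreal (u x powr p) \<partial>\<mu>)"
    using partial_sums_bounded by metis
  \<comment> \<open>Large enough that the bound \<open>K\<^sup>2 / (m + 1)\<^sup>p\<close> for the \<open>m\<close>-th power is at most \<open>1/2\<close>.\<close>
  define m where "m = Suc (nat \<lceil>2 * K\<^sup>2\<rceil>)"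
  have "2 * K\<^sup>2 \<le> real (Suc m)" unfolding m_def by linarith
  also have "\<dots> = real (Suc m) powr 1" by simp
  also have "\<dots> \<le> real (Suc m) powr p" using p by (intro powr_mono) auto
  finally have m: "2 * K\<^sup>2 \<le> real (Suc m) powr p" .
  have m0: "0 < m" by (simp add: m_def)
  define G where "G = growth_rate \<mu> \<alpha> \<psi>"
  have z0m: "(z0 ^ m) powr p = exp (G * real m)"
    using p by (simp add: z0_def G_def exp_of_nat_mult[symmetric] exp_powr_real)
  define s where "s = G - ln 2 / real m"
  have exps: "exp (s * real m) = exp (G * real m) / 2"
    using m0 by (simp add: s_def left_diff_distrib exp_diff)
  have "s \<in> growth_exponents \<mu> \<alpha> \<psi>"
  proof (rule growth_exponentsI_one_time[OF scaled_bounded _ m0])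
    fix w :: "'a \<Rightarrow> real" assume wm [measurable]: "w \<in> borel_measurable \<mu>" and w0: "\<And>x. 0 \<le> w x"
    show "(\<integral>\<^sup>+x. ennreal (exp (birkhoff_sum \<alpha> \<psi> m x) * w ((\<alpha> ^^ m) x)) \<partial>\<mu>)
       \<le> ennreal (exp (s * real m)) * (\<integral>\<^sup>+x. ennreal (w x) \<partial>\<mu>)"
    proof (cases "(\<integral>\<^sup>+x. ennreal (w x) \<partial>\<mu>) < \<infinity>")
      case False
      then have "(\<integral>\<^sup>+x. ennreal (w x) \<partial>\<mu>) = \<infinity>" by (simp add: less_top[symmetric])
      then show ?thesis by (simp add: ennreal_mult_top)
    next
      case True
      define u where "u x = w x powr (1 / p)" for x
      have um [measurable]: "u \<in> borel_measurable \<mu>" unfolding u_def[abs_def] by measurable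
      have u0: "0 \<le> u x" for x by (simp add: u_def)
      have up: "u x powr p = w x" for x using p w0 by (simp add: u_def powr_powr)
      have ufin: "(\<integral>\<^sup>+x. ennreal (u x powr p) \<partial>\<mu>) < \<infinity>" using True by (simp add: up)
      let ?v = "partial_sum (Suc m) u"
      have v: "(\<integral>\<^sup>+x. ennreal (?v x powr p) \<partial>\<mu>) \<le> ennreal K * (\<integral>\<^sup>+x. ennreal (w x) \<partial>\<mu>)"
        using bound[OF um u0 ufin] by (simp add: up)
      then have vfin: "(\<integral>\<^sup>+x. ennreal (?v x powr p) \<partial>\<mu>) < \<infinity>"
        using True by (auto simp: ennreal_mult_less_top intro: order_le_less_trans)
      define c where "c = (real (Suc m) / z0 ^ m) powr p"
      have c: "0 < c" using z0_pos by (simp add: c_def)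
      have "ennreal c * (\<integral>\<^sup>+x. ennreal (exp (birkhoff_sum \<alpha> \<psi> m x) * w ((\<alpha> ^^ m) x)) \<partial>\<mu>)
          = (\<integral>\<^sup>+x. ennreal c * ennreal (exp (birkhoff_sum \<alpha> \<psi> m x) * w ((\<alpha> ^^ m) x)) \<partial>\<mu>)"
        by (rule nn_integral_cmult[symmetric]) measurable
      also have "\<dots> \<le> (\<integral>\<^sup>+x. ennreal (partial_sum (Suc m) ?v x powr p) \<partial>\<mu>)"
      proof (rule nn_integral_mono)
        fix x
        have "c * (exp (birkhoff_sum \<alpha> \<psi> m x) * w ((\<alpha> ^^ m) x)) = (real (Suc m) * (pos_iter m u x / z0 ^ m)) powr p"
        proof -
          have "pos_iter m u x powr p = exp (birkhoff_sum \<alpha> \<psi> m x) * w ((\<alpha> ^^ m) x)"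
            by (simp add: pos_iter_def powr_mult up birkhoff_scaled exp_powr_real mult.commute)
          moreover have "real (Suc m) * (pos_iter m u x / z0 ^ m) = (real (Suc m) / z0 ^ m) * pos_iter m u x"
            by simp
          ultimately show ?thesis unfolding c_def by (simp only: powr_mult)
        qed
        also have "\<dots> \<le> partial_sum (Suc m) ?v x powr p"
          using p z0_pos u0 by (intro powr_mono2 partial_sum_twice_ge) (auto simp: pos_iter_nonneg)
        finally show "ennreal c * ennreal (exp (birkhoff_sum \<alpha> \<psi> m x) * w ((\<alpha> ^^ m) x)) \<le>
            ennreal (partial_sum (Suc m) ?v x powr p)"
          using c by (simp add: ennreal_mult'[symmetric] ennreal_leI)
      qed
      also have "\<dots> \<le> ennreal K * (\<integral>\<^sup>+x. ennreal (?v x powr p) \<partial>\<mu>)"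
        by (rule bound[OF measurable_partial_sum[OF um] partial_sum_nonneg vfin]) (rule u0)
      also have "\<dots> \<le> ennreal K * (ennreal K * (\<integral>\<^sup>+x. ennreal (w x) \<partial>\<mu>))"
        by (intro mult_left_mono v) auto
      finally have main: "ennreal c * (\<integral>\<^sup>+x. ennreal (exp (birkhoff_sum \<alpha> \<psi> m x) * w ((\<alpha> ^^ m) x)) \<partial>\<mu>)
          \<le> ennreal K * (ennreal K * (\<integral>\<^sup>+x. ennreal (w x) \<partial>\<mu>))" .
      have "(\<integral>\<^sup>+x. ennreal (exp (birkhoff_sum \<alpha> \<psi> m x) * w ((\<alpha> ^^ m) x)) \<partial>\<mu>)
          = ennreal (1 / c) * (ennreal c * (\<integral>\<^sup>+x. ennreal (exp (birkhoff_sum \<alpha> \<psi> m x) * w ((\<alpha> ^^ m) x)) \<partial>\<mu>))"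
        using c by (simp add: mult.assoc[symmetric] ennreal_mult'[symmetric])
      also have "\<dots> \<le> ennreal (1 / c) * (ennreal K * (ennreal K * (\<integral>\<^sup>+x. ennreal (w x) \<partial>\<mu>)))"
        using main by (rule mult_left_mono) simp
      also have "\<dots> = ennreal (K\<^sup>2 / c) * (\<integral>\<^sup>+x. ennreal (w x) \<partial>\<mu>)"
      proof -
        have "K\<^sup>2 / c = (1 / c) * (K * K)" by (simp add: power2_eq_square)
        then show ?thesis using K c by (simp only: ennreal_mult mult_nonneg_nonneg less_imp_le mult.assoc divide_nonneg_nonneg zero_le_one)
      qed
      also have "\<dots> \<le> ennreal (exp (s * real m)) * (\<integral>\<^sup>+x. ennreal (w x) \<partial>\<mu>)"
      proof (rule mult_right_mono, rule ennreal_leI)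
        have "c = real (Suc m) powr p / exp (G * real m)"
          unfolding c_def z0m[symmetric] using z0_pos by (simp only: powr_divide)
        then have "K\<^sup>2 / c = K\<^sup>2 / real (Suc m) powr p * exp (G * real m)" by simp
        also have "\<dots> \<le> 1 / 2 * exp (G * real m)"
          using m by (intro mult_right_mono) (auto simp: field_simps)
        finally show "K\<^sup>2 / c \<le> exp (s * real m)" by (simp add: exps)
      qed simp
      finally show ?thesis .
    qed
  qed simp
  then have "G \<le> s"
    unfolding G_def growth_rate_def
    by (rule cInf_lower) (rule growth_exponents_bdd_below[OF scaled_bounded])
  moreover have "0 < ln 2 / real m" using m0 by simp
  ultimately show False unfolding s_def by linarith
qed

theorem spectral_radius: "Lp_spectral_radius \<mu> p T = exp (growth_rate \<mu> \<alpha> \<psi> / p)"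
  unfolding Lp_spectral_radius_def
proof (rule cSup_eq_maximum)
  show "exp (growth_rate \<mu> \<alpha> \<psi> / p) \<in> cmod ` Lp_spectrum \<mu> p T"
    using growth_rate_in_spectrum by (force simp: z0_def image_iff)
  show "x \<le> exp (growth_rate \<mu> \<alpha> \<psi> / p)" if "x \<in> cmod ` Lp_spectrum \<mu> p T" for x
    using that not_in_spectrum by (force simp: not_less[symmetric])
qed

end

section \<open>The cumulant-generating function on an exponential scale\<close>

lemma exp_interpolation:
  fixes y \<theta> :: real
  assumes "0 \<le> \<theta>" "\<theta> \<le> 1"
  shows "exp (\<theta> * y) \<le> (1 - \<theta>) + \<theta> * exp y"
  using convex_onD[OF exp_convex assms, of 0 y] by simp

locale nonnegative_cramer = prob_space P for P :: "'w measure" +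
  fixes X :: "'w \<Rightarrow> real"
  assumes X_measurable [measurable]: "X \<in> borel_measurable P"
    and X_nonneg: "AE w in P. 0 \<le> X w"
    and cramer: "cramer_condition P X"
begin

lemma mgf_ge_1: "0 \<le> t \<Longrightarrow> 1 \<le> mgf P X t"
proof -
  assume t: "0 \<le> t"
  have "(\<integral>\<^sup>+w. 1 \<partial>P) \<le> mgf P X t"
    unfolding mgf_def
    by (rule nn_integral_mono_AE) (use X_nonneg in \<open>eventually_elim, use t in auto\<close>)
  then show ?thesis by (simp add: emeasure_space_1)
qed

lemma mgf_finite_somewhere:
  obtains c where "0 < c" "mgf P X c < \<infinity>"
proof -
  obtain c where c: "c > 0" "(\<integral>\<^sup>+ w. ennreal (exp (c * \<bar>X w\<bar>)) \<partial>P) < \<infinity>"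
    using cramer unfolding cramer_condition_def by blast
  have "mgf P X c \<le> (\<integral>\<^sup>+ w. ennreal (exp (c * \<bar>X w\<bar>)) \<partial>P)"
    unfolding mgf_def using c(1) by (intro nn_integral_mono) (auto intro: ennreal_leI)
  with c that show thesis by (meson order_le_less_trans)
qed

text \<open>
  Together with \<open>M\<^sub>X(c) < \<infinity>\<close> for a single \<open>c > 0\<close>, convexity between \<open>0\<close> and \<open>c\<close> controls \<open>M\<^sub>X\<close> near \<open>0\<close>
  without a convergence theorem.
\<close>

lemma mgf_interpolation:
  assumes "0 \<le> \<theta>" "\<theta> \<le> 1"
  shows "mgf P X (\<theta> * c) \<le> ennreal (1 - \<theta>) + ennreal \<theta> * mgf P X c"
proof -
  have "mgf P X (\<theta> * c) \<le> (\<integral>\<^sup>+w. ennreal (1 - \<theta>) + ennreal \<theta> * ennreal (exp (c * X w)) \<partial>P)"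
    unfolding mgf_def
  proof (rule nn_integral_mono)
    fix w
    have "exp (\<theta> * c * X w) \<le> (1 - \<theta>) + \<theta> * exp (c * X w)"
      using exp_interpolation[OF assms, of "c * X w"] by (simp add: mult.assoc)
    then show "ennreal (exp (\<theta> * c * X w)) \<le> ennreal (1 - \<theta>) + ennreal \<theta> * ennreal (exp (c * X w))"
      using assms by (simp add: ennreal_mult'[symmetric] ennreal_plus[symmetric] ennreal_leI del: ennreal_plus)
  qed
  also have "\<dots> = ennreal (1 - \<theta>) + ennreal \<theta> * mgf P X c"
    unfolding mgf_def by (simp add: nn_integral_add nn_integral_cmult emeasure_space_1)
  finally show ?thesis .
qed

lemma ext_ln_ennreal: "0 < m \<Longrightarrow> ext_ln (ennreal m) = ereal (ln m)"
  by (simp add: ext_ln_def)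

lemma ln_mgf_exp_nonneg: "0 \<le> ln_mgf_exp P X t"
proof (cases "mgf P X (exp t)")
  case (real m)
  then have "1 \<le> m" using mgf_ge_1[of "exp t"] by (simp add: ennreal_ge_1)
  then show ?thesis unfolding ln_mgf_exp_def real by (simp add: ext_ln_ennreal)
next
  case top
  then show ?thesis by (simp add: ln_mgf_exp_def ext_ln_def)
qed

text \<open>
  This single estimate of \<open>F = ln M\<^sub>X \<circ> exp\<close> near \<open>-\<infinity>\<close> gives all that is needed about its conjugate: that it is nowhere
  \<open>-\<infinity>\<close>, vanishes at \<open>0\<close> and is \<open>\<infinity>\<close> on the negative half-line.
\<close>

lemma ln_mgf_exp_at_bot:
  obtains s0 D where "0 \<le> D" "\<And>s. s \<le> s0 \<Longrightarrow> ln_mgf_exp P X s \<le> ereal (D * exp s)"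
proof -
  obtain c where c: "0 < c" "mgf P X c < \<infinity>" by (rule mgf_finite_somewhere)
  then obtain C where C: "mgf P X c = ennreal C" "0 \<le> C" by (cases "mgf P X c") auto
  then have C1: "1 \<le> C" using mgf_ge_1[of c] c by (simp add: ennreal_ge_1)
  show thesis
  proof (rule that[of "(C - 1) / c" "ln c"])
    show "0 \<le> (C - 1) / c" using C1 c by simp
    fix s assume "s \<le> ln c"
    then have "exp s \<le> c" using c by (metis exp_le_cancel_iff exp_ln)
    define \<theta> where "\<theta> = exp s / c"
    have \<theta>: "0 \<le> \<theta>" "\<theta> \<le> 1" "exp s = \<theta> * c" using c \<open>exp s \<le> c\<close> by (auto simp: \<theta>_def)
    have le: "mgf P X (exp s) \<le> ennreal ((1 - \<theta>) + \<theta> * C)"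
      using mgf_interpolation[OF \<theta>(1,2), of c] \<theta> C
      by (simp add: ennreal_mult'[symmetric] ennreal_plus[symmetric] del: ennreal_plus)
    then obtain m where m: "mgf P X (exp s) = ennreal m" "0 \<le> m"
      by (cases "mgf P X (exp s)") (auto simp: top_unique)
    then have "1 \<le> m" using mgf_ge_1[of "exp s"] by (simp add: ennreal_ge_1)
    have "0 \<le> (1 - \<theta>) + \<theta> * C" using \<theta> C by simp
    then have "m \<le> 1 + \<theta> * (C - 1)" using le m by (simp add: algebra_simps)
    have "ln m \<le> m - 1" using \<open>1 \<le> m\<close> by (intro ln_le_minus_one) simp
    also have "\<dots> \<le> \<theta> * (C - 1)" using \<open>m \<le> 1 + \<theta> * (C - 1)\<close> by simp
    also have "\<dots> = (C - 1) / c * exp s" by (simp add: \<theta>_def)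
    finally have "ln m \<le> (C - 1) / c * exp s" .
    moreover have "ln_mgf_exp P X s = ereal (ln m)"
      unfolding ln_mgf_exp_def m(1) using \<open>1 \<le> m\<close> by (simp add: ext_ln_ennreal)
    ultimately show "ln_mgf_exp P X s \<le> ereal ((C - 1) / c * exp s)" by simp
  qed
qed

lemma conjugate_not_minus_infinity: "conjugate_real (ln_mgf_exp P X) a \<noteq> -\<infinity>"
proof -
  obtain s0 D where D: "\<And>s. s \<le> s0 \<Longrightarrow> ln_mgf_exp P X s \<le> ereal (D * exp s)"
    using ln_mgf_exp_at_bot by metis
  have "ereal (a * s0) - ereal (D * exp s0) \<le> ereal (a * s0) - ln_mgf_exp P X s0"
    by (intro ereal_minus_mono D) auto
  also have "\<dots> \<le> conjugate_real (ln_mgf_exp P X) a"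
    unfolding conjugate_real_def conjugate_def by (rule SUP_upper) simp
  finally show ?thesis by auto
qed

lemma conjugate_at_0: "conjugate_real (ln_mgf_exp P X) 0 = 0"
proof (rule antisym)
  show "conjugate_real (ln_mgf_exp P X) 0 \<le> 0"
    unfolding conjugate_real_def conjugate_def
    using ln_mgf_exp_nonneg by (intro SUP_least) (simp add: zero_ereal_def[symmetric])
  obtain s0 D where D: "0 \<le> D" "\<And>s. s \<le> s0 \<Longrightarrow> ln_mgf_exp P X s \<le> ereal (D * exp s)"
    using ln_mgf_exp_at_bot by metis
  show "0 \<le> conjugate_real (ln_mgf_exp P X) 0"
  proof (rule ereal_le_epsilon2)
    fix e :: real assume e: "0 < e"
    define s where "s = min s0 (ln (e / (D + 1)))"
    have "exp s \<le> e / (D + 1)" using e D(1) by (simp add: s_def ln_ge_iff[symmetric] min_def)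
    then have "(D + 1) * exp s \<le> e" using D(1) by (simp add: field_simps)
    then have "D * exp s \<le> e" by (simp add: distrib_right) (smt (verit) exp_gt_zero)
    then have F: "ln_mgf_exp P X s \<le> ereal e"
      using D(2)[of s] by (metis ereal_less_eq(3) min.cobounded1 order_trans s_def)
    have "0 = (ereal 0 - ereal e) + ereal e" by simp
    also have "\<dots> \<le> (ereal (0 * s) - ln_mgf_exp P X s) + ereal e"
      using F by (intro add_right_mono ereal_minus_mono) auto
    also have "\<dots> \<le> conjugate_real (ln_mgf_exp P X) 0 + ereal e"
      unfolding conjugate_real_def conjugate_def by (intro add_right_mono SUP_upper) simp
    finally show "0 \<le> conjugate_real (ln_mgf_exp P X) 0 + ereal e" .
  qed
qed

lemma conjugate_negative:
  assumes "a < 0"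
  shows "conjugate_real (ln_mgf_exp P X) a = \<infinity>"
  unfolding conjugate_real_def conjugate_def
proof (rule SUP_PInfty)
  fix n :: nat
  obtain s0 D where D: "0 \<le> D" "\<And>s. s \<le> s0 \<Longrightarrow> ln_mgf_exp P X s \<le> ereal (D * exp s)"
    using ln_mgf_exp_at_bot by metis
  define s where "s = min (min s0 0) ((real n + D) / a)"
  have s: "s \<le> s0" "s \<le> 0" "s \<le> (real n + D) / a" by (auto simp: s_def)
  have "real n + D \<le> a * s" using s(3) assms by (simp add: neg_le_divide_eq mult.commute)
  moreover have "D * exp s \<le> D * 1" using s(2) D(1) by (intro mult_left_mono) auto
  ultimately have "ereal (real n) \<le> ereal (a * s) - ereal (D * exp s)" by simp
  also have "\<dots> \<le> ereal (a * s) - ln_mgf_exp P X s" by (intro ereal_minus_mono D s) auto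
  finally show "\<exists>i\<in>UNIV. ereal (real n) \<le> ereal (a * i) - ln_mgf_exp P X i" by blast
qed

end

section \<open>Conjugates of composed functionals\<close>

text \<open>
  The substitution \<open>\<phi> = \<psi> + (s - lam \<psi>) e\<close> makes the value \<open>s = lam \<phi>\<close> and the direction \<open>\<psi>\<close> independent variables,
  in which the supremum separates.
\<close>

lemma conjugate_translation_equivariant:
  fixes lam :: "'v::real_normed_vector \<Rightarrow> real" and F :: "real \<Rightarrow> ereal"
  assumes shift: "\<And>\<phi> c. lam (\<phi> + c *\<^sub>R e) = lam \<phi> + c"
    and proper: "conjugate_real F (blinfun_apply \<Lambda> e) \<noteq> -\<infinity>"
  shows "conjugate_dual (\<lambda>\<phi>. F (lam \<phi>)) \<Lambda> =
     (SUP \<psi>. ereal (blinfun_apply \<Lambda> \<psi> - blinfun_apply \<Lambda> e * lam \<psi>)) + conjugate_real F (blinfun_apply \<Lambda> e)"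
    (is "?L = ?S + ?F")
proof (rule antisym)
  let ?a = "blinfun_apply \<Lambda> e"
  have F_ge: "ereal (?a * s) - F s \<le> ?F" for s
    unfolding conjugate_real_def conjugate_def by (rule SUP_upper) simp
  show "?L \<le> ?S + ?F"
    unfolding conjugate_dual_def conjugate_def[of "\<lambda>\<phi>. F (lam \<phi>)"]
  proof (rule SUP_least)
    fix \<phi>
    have "ereal (blinfun_apply \<Lambda> \<phi>) - F (lam \<phi>)
        = ereal (blinfun_apply \<Lambda> \<phi> - ?a * lam \<phi>) + (ereal (?a * lam \<phi>) - F (lam \<phi>))"
      by (cases "F (lam \<phi>)") auto
    also have "\<dots> \<le> ?S + ?F" by (intro add_mono SUP_upper F_ge) simp
    finally show "ereal (blinfun_apply \<Lambda> \<phi>) - F (lam \<phi>) \<le> ?S + ?F" .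
  qed
  show "?S + ?F \<le> ?L"
    unfolding SUP_ereal_add_left[OF UNIV_not_empty proper, symmetric]
  proof (rule SUP_least)
    fix \<psi>
    have "ereal (blinfun_apply \<Lambda> \<psi> - ?a * lam \<psi>) + ?F
        = (SUP s. ereal (blinfun_apply \<Lambda> \<psi> - ?a * lam \<psi>) + (ereal (?a * s) - F s))"
      unfolding conjugate_real_def conjugate_def by (rule SUP_ereal_add_right[symmetric]) auto
    also have "\<dots> \<le> ?L"
    proof (rule SUP_least)
      fix s
      let ?\<phi> = "\<psi> + (s - lam \<psi>) *\<^sub>R e"
      have "lam ?\<phi> = s" by (simp add: shift)
      moreover have "blinfun_apply \<Lambda> ?\<phi> = blinfun_apply \<Lambda> \<psi> - ?a * lam \<psi> + ?a * s"
        unfolding blinfun.add_right blinfun.scaleR_right by (simp add: algebra_simps)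
      ultimately have "ereal (blinfun_apply \<Lambda> \<psi> - ?a * lam \<psi>) + (ereal (?a * s) - F s)
          = ereal (blinfun_apply \<Lambda> ?\<phi>) - F (lam ?\<phi>)"
        by (cases "F s") auto
      also have "\<dots> \<le> ?L"
        unfolding conjugate_dual_def conjugate_def[of "\<lambda>\<phi>. F (lam \<phi>)"] by (rule SUP_upper) simp
      finally show "ereal (blinfun_apply \<Lambda> \<psi> - ?a * lam \<psi>) + (ereal (?a * s) - F s) \<le> ?L" .
    qed
    finally show "ereal (blinfun_apply \<Lambda> \<psi> - ?a * lam \<psi>) + ?F \<le> ?L" .
  qed
qed

section \<open>Invariant functionals are invariant measures\<close>

definition compose_bcontfun :: "('a::topological_space \<Rightarrow> 'a) \<Rightarrow> ('a \<Rightarrow>\<^sub>C real) \<Rightarrow> ('a \<Rightarrow>\<^sub>C real)" where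
  "compose_bcontfun \<alpha> \<phi> = Bcontfun (\<lambda>x. apply_bcontfun \<phi> (\<alpha> x))"

lemma apply_compose_bcontfun:
  assumes "continuous_on UNIV \<alpha>"
  shows "apply_bcontfun (compose_bcontfun \<alpha> \<phi>) x = apply_bcontfun \<phi> (\<alpha> x)"
proof -
  have "(\<lambda>x. apply_bcontfun \<phi> (\<alpha> x)) \<in> bcontfun"
  proof (rule bcontfun_normI)
    show "continuous_on UNIV (\<lambda>x. apply_bcontfun \<phi> (\<alpha> x))"
      using continuous_on_compose2[OF continuous_on_apply_bcontfun[of UNIV \<phi>] assms] by simp
    show "norm (apply_bcontfun \<phi> (\<alpha> x)) \<le> norm \<phi>" for x by (rule norm_bounded)
  qed
  then show ?thesis unfolding compose_bcontfun_def by (simp add: Bcontfun_inverse)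
qed

lemma Bcontfun_of_continuous:
  assumes "compact (UNIV :: 'a::topological_space set)" "continuous_on UNIV (f :: 'a \<Rightarrow> real)"
  shows "apply_bcontfun (Bcontfun f) = f"
proof -
  have "bounded (range f)"
    using assms by (intro compact_imp_bounded compact_continuous_image)
  then have "f \<in> bcontfun" using assms(2) by (simp add: bcontfun_def)
  then show ?thesis by (rule Bcontfun_inverse)
qed

lemma invariant_functional_is_measure:
  fixes \<Lambda> :: "('a::t2_space \<Rightarrow>\<^sub>C real) \<Rightarrow> real"
  assumes comp: "compact (UNIV :: 'a set)" and cont: "continuous_on UNIV \<alpha>"
    and add: "\<And>\<phi> \<psi>. \<Lambda> (\<phi> + \<psi>) = \<Lambda> \<phi> + \<Lambda> \<psi>"
    and scale: "\<And>c \<phi>. \<Lambda> (c *\<^sub>R \<phi>) = c * \<Lambda> \<phi>"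
    and nonneg: "\<And>\<phi>. (\<And>x. 0 \<le> apply_bcontfun \<phi> x) \<Longrightarrow> 0 \<le> \<Lambda> \<phi>"
    and one: "\<Lambda> (const_bcontfun 1) = 1"
    and inv: "\<And>\<phi>. \<Lambda> (compose_bcontfun \<alpha> \<phi>) = \<Lambda> \<phi>"
  obtains \<nu> where "\<nu> \<in> invariant_probs \<alpha>" "\<And>\<phi>. \<Lambda> \<phi> = (\<integral>x. apply_bcontfun \<phi> x \<partial>\<nu>)"
proof -
  define L where "L f = \<Lambda> (Bcontfun f)" for f
  note ap = Bcontfun_of_continuous[OF comp]
  interpret normalized_positive_functional L
  proof
    show "compact (UNIV :: 'a set)" by (rule comp)
    fix f g :: "'a \<Rightarrow> real" and c :: real assume f: "continuous_on UNIV f"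
    show "L (\<lambda>x. c * f x) = c * L f"
    proof -
      have "Bcontfun (\<lambda>x. c * f x) = c *\<^sub>R Bcontfun f"
        by (rule bcontfun_eqI) (simp add: ap f continuous_on_mult_left)
      then show ?thesis by (simp add: L_def scale)
    qed
    show "0 \<le> L f" if "\<And>x. 0 \<le> f x"
      unfolding L_def using that by (intro nonneg) (simp add: ap f)
    assume g: "continuous_on UNIV g"
    have "Bcontfun (\<lambda>x. f x + g x) = Bcontfun f + Bcontfun g"
      by (rule bcontfun_eqI) (simp add: ap f g continuous_on_add)
    then show "L (\<lambda>x. f x + g x) = L f + L g" by (simp add: L_def add)
  next
    have "Bcontfun (\<lambda>_::'a. 1::real) = const_bcontfun 1"
      by (rule bcontfun_eqI) (simp add: ap)
    then show "L (\<lambda>_. 1) = 1" by (simp add: L_def one)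
  qed
  show thesis
  proof (rule that)
    have "L (\<lambda>x. f (\<alpha> x)) = L f" if f: "continuous_on UNIV f" for f
    proof -
      have "Bcontfun (\<lambda>x. f (\<alpha> x)) = compose_bcontfun \<alpha> (Bcontfun f)"
        unfolding compose_bcontfun_def by (simp add: ap f)
      then show ?thesis by (simp add: L_def inv)
    qed
    then have "distr representing_measure borel \<alpha> = representing_measure"
      by (rule invariant_representing[OF cont])
    then show "representing_measure \<in> invariant_probs \<alpha>"
      using prob_space_representing regular_representing by (simp add: invariant_probs_def)
    show "\<Lambda> \<phi> = (\<integral>x. apply_bcontfun \<phi> x \<partial>representing_measure)" for \<phi>
      using integral_representing[of "apply_bcontfun \<phi>"] by (simp add: L_def apply_bcontfun_inverse)
  qed
qed

section \<open>Existence of an invariant probability measure\<close>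

lemma cluster_point_closed:
  assumes cl: "inf (nhds a) (filtermap X sequentially) \<noteq> bot" and Z: "closed Z"
    and ev: "eventually (\<lambda>n. X n \<in> Z) sequentially"
  shows "a \<in> Z"
proof (rule ccontr)
  assume "a \<notin> Z"
  then have "eventually (\<lambda>y. y \<in> - Z) (nhds a)" using Z by (intro eventually_nhds_in_open) auto
  moreover have "eventually (\<lambda>y. y \<in> Z) (filtermap X sequentially)"
    using ev by (simp add: eventually_filtermap)
  ultimately have "eventually (\<lambda>y. False) (inf (nhds a) (filtermap X sequentially))"
    unfolding eventually_inf by blast
  then show False using cl by (simp add: trivial_limit_def)
qed

text \<open>
  Krylov-Bogolyubov: the Birkhoff averages along the orbit of a point lie in a product of compact intervals, indexed by
  the continuous functions.  A cluster point in the product topology keeps every closed condition that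
  holds eventually, in particular linearity, positivity and invariance.
\<close>

lemma exists_invariant_prob:
  assumes comp: "compact (UNIV :: 'a::t2_space set)" and cont: "continuous_on UNIV (\<alpha> :: 'a \<Rightarrow> 'a)"
  obtains \<nu> where "\<nu> \<in> invariant_probs \<alpha>"
proof -
  define x0 :: 'a where "x0 = undefined"
  define A :: "nat \<Rightarrow> ('a \<Rightarrow>\<^sub>C real) \<Rightarrow> real" where
    "A n \<phi> = birkhoff_sum \<alpha> (apply_bcontfun \<phi>) (Suc n) x0 / real (Suc n)" for n \<phi>
  define K :: "(('a \<Rightarrow>\<^sub>C real) \<Rightarrow> real) set" where "K = PiE UNIV (\<lambda>\<phi>. {- norm \<phi>..norm \<phi>})"
  have bound: "\<bar>birkhoff_sum \<alpha> (apply_bcontfun \<phi>) n x\<bar> \<le> real n * norm \<phi>" for n \<phi> x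
    using norm_bounded[of \<phi>] by (intro birkhoff_sum_bound) simp
  have "compactin (product_topology (\<lambda>_. euclidean) UNIV) K"
    unfolding K_def compactin_PiE by simp
  then have "compact K" by (simp add: euclidean_product_topology)
  moreover have "A n \<in> K" for n
  proof -
    have "\<bar>A n \<phi>\<bar> \<le> norm \<phi>" for \<phi>
      using bound[of \<phi> "Suc n" x0] by (simp add: A_def divide_le_eq mult.commute del: of_nat_Suc)
    then show ?thesis by (auto simp: K_def PiE_UNIV_domain abs_le_iff minus_le_iff)
  qed
  then have "eventually (\<lambda>y. y \<in> K) (filtermap A sequentially)"
    by (simp add: eventually_filtermap)
  moreover have "filtermap A sequentially \<noteq> bot" by (simp add: filtermap_bot_iff)
  ultimately obtain \<Lambda> where cl: "inf (nhds \<Lambda>) (filtermap A sequentially) \<noteq> bot"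
    unfolding compact_filter by blast
  have closed: "P \<Lambda>" if "closed {y. P y}" "eventually (\<lambda>n. P (A n)) sequentially" for P
    using cluster_point_closed[OF cl that(1)] that(2) by simp
  have add: "\<Lambda> (\<phi> + \<psi>) = \<Lambda> \<phi> + \<Lambda> \<psi>" for \<phi> \<psi>
  proof (rule closed)
    show "closed {y. y (\<phi> + \<psi>) = y \<phi> + (y \<psi> :: real)}"
      by (intro closed_Collect_eq continuous_intros continuous_on_product_coordinates)
    show "\<forall>\<^sub>F n in sequentially. A n (\<phi> + \<psi>) = A n \<phi> + A n \<psi>"
      by (simp add: A_def birkhoff_sum_def sum.distrib add_divide_distrib)
  qed
  have scale: "\<Lambda> (c *\<^sub>R \<phi>) = c * \<Lambda> \<phi>" for c \<phi>
  proof (rule closed)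
    show "closed {y. y (c *\<^sub>R \<phi>) = c * (y \<phi> :: real)}"
      by (intro closed_Collect_eq continuous_intros continuous_on_product_coordinates)
    show "\<forall>\<^sub>F n in sequentially. A n (c *\<^sub>R \<phi>) = c * A n \<phi>"
      by (simp add: A_def birkhoff_sum_def sum_distrib_left distrib_left)
  qed
  have nonneg: "0 \<le> \<Lambda> \<phi>" if \<phi>: "\<And>x. 0 \<le> apply_bcontfun \<phi> x" for \<phi>
  proof (rule closed)
    show "closed {y. 0 \<le> (y \<phi> :: real)}"
      by (intro closed_Collect_le continuous_intros continuous_on_product_coordinates)
    show "\<forall>\<^sub>F n in sequentially. 0 \<le> A n \<phi>"
      unfolding A_def birkhoff_sum_def by (intro always_eventually allI divide_nonneg_nonneg sum_nonneg \<phi>) simp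
  qed
  have one: "\<Lambda> (const_bcontfun 1) = 1"
  proof (rule closed)
    show "closed {y. y (const_bcontfun 1) = (1 :: real)}"
      by (intro closed_Collect_eq continuous_intros continuous_on_product_coordinates)
    show "\<forall>\<^sub>F n in sequentially. A n (const_bcontfun 1) = 1"
      by (intro always_eventually allI) (simp add: A_def birkhoff_sum_def)
  qed
  have inv: "\<Lambda> (compose_bcontfun \<alpha> \<phi>) = \<Lambda> \<phi>" for \<phi>
  proof -
    let ?\<psi> = "compose_bcontfun \<alpha> \<phi>"
    have diff: "\<bar>A n ?\<psi> - A n \<phi>\<bar> \<le> 2 * norm \<phi> / real (Suc n)" for n
    proof -
      let ?b = "birkhoff_sum \<alpha> (apply_bcontfun \<phi>)"
      have "birkhoff_sum \<alpha> (apply_bcontfun ?\<psi>) (Suc n) x0 = ?b (Suc n) (\<alpha> x0)"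
        by (simp add: birkhoff_sum_def apply_compose_bcontfun[OF cont] funpow_swap1)
      moreover have "?b (Suc (Suc n)) x0 = apply_bcontfun \<phi> x0 + ?b (Suc n) (\<alpha> x0)"
        by (rule birkhoff_sum_Suc)
      moreover have "?b (Suc (Suc n)) x0 = ?b (Suc n) x0 + apply_bcontfun \<phi> ((\<alpha> ^^ Suc n) x0)"
        by (simp add: birkhoff_sum_def)
      ultimately have "birkhoff_sum \<alpha> (apply_bcontfun ?\<psi>) (Suc n) x0 - ?b (Suc n) x0
          = apply_bcontfun \<phi> ((\<alpha> ^^ Suc n) x0) - apply_bcontfun \<phi> x0" by linarith
      moreover have "\<bar>apply_bcontfun \<phi> ((\<alpha> ^^ Suc n) x0) - apply_bcontfun \<phi> x0\<bar> \<le> 2 * norm \<phi>"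
        using norm_bounded[of \<phi> "(\<alpha> ^^ Suc n) x0"] norm_bounded[of \<phi> x0] unfolding real_norm_def by linarith
      ultimately have "\<bar>birkhoff_sum \<alpha> (apply_bcontfun ?\<psi>) (Suc n) x0 - ?b (Suc n) x0\<bar> / real (Suc n)
          \<le> 2 * norm \<phi> / real (Suc n)"
        by (intro divide_right_mono) auto
      then show ?thesis by (simp add: A_def diff_divide_distrib[symmetric] abs_divide)
    qed
    have "\<bar>\<Lambda> ?\<psi> - \<Lambda> \<phi>\<bar> \<le> e" if e: "0 < e" for e
    proof (rule closed)
      show "closed {y. \<bar>y ?\<psi> - (y \<phi> :: real)\<bar> \<le> e}"
        by (intro closed_Collect_le continuous_intros continuous_on_product_coordinates)
      have "(\<lambda>n. 2 * norm \<phi> / real (Suc n)) \<longlonglongrightarrow> 0"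
        using LIMSEQ_Suc[OF lim_const_over_n[of "2 * norm \<phi>"]] by simp
      then have "\<forall>\<^sub>F n in sequentially. 2 * norm \<phi> / real (Suc n) < e"
        using e by (rule order_tendstoD)
      then show "\<forall>\<^sub>F n in sequentially. \<bar>A n ?\<psi> - A n \<phi>\<bar> \<le> e"
        by eventually_elim (use diff in \<open>meson less_imp_le order_trans\<close>)
    qed
    then have "\<bar>\<Lambda> ?\<psi> - \<Lambda> \<phi>\<bar> \<le> 0" by (rule field_le_epsilon) simp
    then show ?thesis by simp
  qed
  show thesis
    using invariant_functional_is_measure[OF comp cont add scale nonneg one inv] that by metis
qed

section \<open>The spectral exponent\<close>

locale spectral_exponent_system =
  fixes \<mu> :: "'a::t2_space measure" and \<alpha> :: "'a \<Rightarrow> 'a"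
  assumes sets_eq: "sets \<mu> = sets borel"
    and pos_fin: "\<exists>A\<in>sets \<mu>. 0 < emeasure \<mu> A \<and> emeasure \<mu> A < \<infinity>"
    and cont: "continuous_on UNIV \<alpha>"
    and preserved: "distr \<mu> borel \<alpha> = \<mu>"
begin

sublocale measure_preserving_system \<mu> \<alpha>
proof
  have "\<alpha> \<in> borel_measurable borel" using cont by (rule borel_measurable_continuous_onI)
  then show "\<alpha> \<in> measurable \<mu> \<mu>" by (simp cong: measurable_cong_sets add: sets_eq)
  show "distr \<mu> \<mu> \<alpha> = \<mu>" using preserved distr_cong[OF refl sets_eq, of \<mu> \<alpha> \<alpha>] by simp
qed (rule pos_fin)

lemma bcontfun_measurable [measurable]: "apply_bcontfun (\<phi> :: 'a \<Rightarrow>\<^sub>C real) \<in> borel_measurable \<mu>"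
proof -
  have "apply_bcontfun \<phi> \<in> borel_measurable borel"
    by (intro borel_measurable_continuous_onI continuous_on_apply_bcontfun)
  then show ?thesis by (simp cong: measurable_cong_sets add: sets_eq)
qed

lemma bcontfun_scaled_bound:
  "0 \<le> p \<Longrightarrow> \<bar>p * apply_bcontfun (\<phi> :: 'a \<Rightarrow>\<^sub>C real) x\<bar> \<le> p * norm \<phi>"
  using norm_bounded[of \<phi> x] by (simp add: abs_mult mult_left_mono)

lemma spectral_exponent_eq:
  assumes "1 \<le> p"
  shows "spectral_exponent \<mu> \<alpha> p \<phi> = growth_rate \<mu> \<alpha> (\<lambda>x. p * apply_bcontfun \<phi> x) / p"
proof -
  interpret weighted_system \<mu> \<alpha> p "apply_bcontfun \<phi>" "norm \<phi>"
    using assms norm_bounded[of \<phi>] by unfold_locales auto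
  show ?thesis by (simp add: spectral_exponent_def spectral_radius)
qed

lemma spectral_exponent_le:
  assumes p: "1 \<le> p"
    and le: "\<And>n x. birkhoff_sum \<alpha> (apply_bcontfun \<phi>) n x \<le> birkhoff_sum \<alpha> (apply_bcontfun \<psi>) n x + c * real n + D"
  shows "spectral_exponent \<mu> \<alpha> p \<phi> \<le> spectral_exponent \<mu> \<alpha> p \<psi> + c"
proof -
  have p0: "0 \<le> p" using p by simp
  have "growth_rate \<mu> \<alpha> (\<lambda>x. p * apply_bcontfun \<phi> x)
      \<le> growth_rate \<mu> \<alpha> (\<lambda>x. p * apply_bcontfun \<psi> x) + p * c"
  proof (rule growth_rate_le[where D = "p * D" and A = "p * norm \<phi>" and B = "p * norm \<psi>"])
    fix n x
    have "p * birkhoff_sum \<alpha> (apply_bcontfun \<phi>) n x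
        \<le> p * (birkhoff_sum \<alpha> (apply_bcontfun \<psi>) n x + c * real n + D)"
      by (rule mult_left_mono[OF le p0])
    then show "birkhoff_sum \<alpha> (\<lambda>x. p * apply_bcontfun \<phi> x) n x
        \<le> birkhoff_sum \<alpha> (\<lambda>x. p * apply_bcontfun \<psi> x) n x + p * c * real n + p * D"
      by (simp add: birkhoff_sum_def sum_distrib_left[symmetric] distrib_left mult.assoc)
  qed (auto intro: bcontfun_scaled_bound[OF p0])
  then show ?thesis using p by (simp add: spectral_exponent_eq field_simps)
qed

lemma spectral_exponent_shift:
  assumes p: "1 \<le> p"
  shows "spectral_exponent \<mu> \<alpha> p (\<phi> + c *\<^sub>R const_bcontfun 1) = spectral_exponent \<mu> \<alpha> p \<phi> + c"
proof -
  let ?\<psi> = "\<phi> + c *\<^sub>R const_bcontfun 1"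
  have eq: "birkhoff_sum \<alpha> (apply_bcontfun ?\<psi>) n x = birkhoff_sum \<alpha> (apply_bcontfun \<phi>) n x + c * real n" for n x
    by (simp add: birkhoff_sum_def sum.distrib mult.commute)
  have "spectral_exponent \<mu> \<alpha> p ?\<psi> \<le> spectral_exponent \<mu> \<alpha> p \<phi> + c"
    by (rule spectral_exponent_le[OF p, where D = 0]) (unfold eq, simp)
  moreover have "spectral_exponent \<mu> \<alpha> p \<phi> \<le> spectral_exponent \<mu> \<alpha> p ?\<psi> + (- c)"
    by (rule spectral_exponent_le[OF p, where D = 0]) (unfold eq, simp)
  ultimately show ?thesis by simp
qed

lemma spectral_exponent_nonpos:
  assumes p: "1 \<le> p" and le: "\<And>n x. birkhoff_sum \<alpha> (apply_bcontfun \<phi>) n x \<le> D"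
  shows "spectral_exponent \<mu> \<alpha> p \<phi> \<le> 0"
proof -
  have "spectral_exponent \<mu> \<alpha> p \<phi> \<le> spectral_exponent \<mu> \<alpha> p 0 + 0"
    by (rule spectral_exponent_le[OF p, where D = D]) (use le in \<open>simp add: birkhoff_sum_def\<close>)
  also have "spectral_exponent \<mu> \<alpha> p 0 = 0"
    by (simp add: spectral_exponent_eq[OF p] growth_rate_zero)
  finally show ?thesis by simp
qed

text \<open>
  Through this identity the \<open>\<^bold>t\<close>-entropy, read off from \<open>p = 1\<close>, governs all exponents.
\<close>

lemma spectral_exponent_rescale:
  assumes "1 \<le> p"
  shows "spectral_exponent \<mu> \<alpha> p \<phi> = spectral_exponent \<mu> \<alpha> 1 (p *\<^sub>R \<phi>) / p"
  by (simp add: spectral_exponent_eq assms)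

lemma nonpos_if_multiples_bounded:
  fixes y C :: real
  assumes "\<And>n::nat. real n * y \<le> C"
  shows "y \<le> 0"
proof (rule ccontr)
  assume "\<not> y \<le> 0"
  then obtain n :: nat where "C < real n * y" using reals_Archimedean3[of y] by auto
  then show False using assms[of n] by simp
qed

text \<open>
  A linear functional that stays bounded above on a ray is \<open>\<le> 0\<close> there.  The spectral exponent is \<open>\<le> 0\<close> on the rays of
  nonpositive functions and of coboundaries of either sign, so finiteness of the supremum makes \<open>\<Lambda>\<close> positive
  and invariant.
\<close>

lemma finite_conjugate_is_invariant:
  fixes \<Lambda> :: "('a \<Rightarrow>\<^sub>C real) \<Rightarrow>\<^sub>L real"
  assumes comp: "compact (UNIV :: 'a set)" and p: "1 \<le> p"
    and mass: "total_mass \<Lambda> = a" "0 < a"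
    and C: "\<And>\<phi>. blinfun_apply \<Lambda> \<phi> - a * spectral_exponent \<mu> \<alpha> p \<phi> \<le> C"
  obtains \<nu> where "\<nu> \<in> invariant_probs \<alpha>" "\<Lambda> = a *\<^sub>R functional_of \<nu>"
proof -
  have bounded_ray: "blinfun_apply \<Lambda> \<phi> \<le> 0"
    if "\<And>t. 0 \<le> t \<Longrightarrow> spectral_exponent \<mu> \<alpha> p (t *\<^sub>R \<phi>) \<le> 0" for \<phi>
  proof (rule nonpos_if_multiples_bounded)
    fix n :: nat
    have "a * spectral_exponent \<mu> \<alpha> p (real n *\<^sub>R \<phi>) \<le> 0"
      using that[of "real n"] mass(2) by (simp add: mult_nonneg_nonpos)
    then show "real n * blinfun_apply \<Lambda> \<phi> \<le> C"
      using C[of "real n *\<^sub>R \<phi>"] by (simp add: blinfun.scaleR_right)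
  qed
  have nonpos: "blinfun_apply \<Lambda> \<phi> \<le> 0" if "\<And>x. apply_bcontfun \<phi> x \<le> 0" for \<phi>
  proof (rule bounded_ray, rule spectral_exponent_nonpos[OF p, where D = 0])
    fix t :: real and n x assume "0 \<le> t"
    then show "birkhoff_sum \<alpha> (apply_bcontfun (t *\<^sub>R \<phi>)) n x \<le> 0"
      unfolding birkhoff_sum_def using that by (intro sum_nonpos) (simp add: mult_nonneg_nonpos)
  qed
  have cob: "blinfun_apply \<Lambda> (s *\<^sub>R (compose_bcontfun \<alpha> \<phi> - \<phi>)) \<le> 0" for s \<phi>
  proof (rule bounded_ray)
    fix t :: real
    show "spectral_exponent \<mu> \<alpha> p (t *\<^sub>R s *\<^sub>R (compose_bcontfun \<alpha> \<phi> - \<phi>)) \<le> 0"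
    proof (rule spectral_exponent_nonpos[OF p])
      fix n x
      have telescope: "birkhoff_sum \<alpha> (apply_bcontfun (t *\<^sub>R s *\<^sub>R (compose_bcontfun \<alpha> \<phi> - \<phi>))) n x
          = t * s * (apply_bcontfun \<phi> ((\<alpha> ^^ n) x) - apply_bcontfun \<phi> x)"
        by (induction n) (auto simp: birkhoff_sum_def apply_compose_bcontfun[OF cont] algebra_simps)
      have "\<bar>apply_bcontfun \<phi> ((\<alpha> ^^ n) x) - apply_bcontfun \<phi> x\<bar> \<le> 2 * norm \<phi>"
        using norm_bounded[of \<phi> "(\<alpha> ^^ n) x"] norm_bounded[of \<phi> x] unfolding real_norm_def by linarith
      then have "\<bar>t * s\<bar> * \<bar>apply_bcontfun \<phi> ((\<alpha> ^^ n) x) - apply_bcontfun \<phi> x\<bar> \<le> \<bar>t * s\<bar> * (2 * norm \<phi>)"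
        by (rule mult_left_mono) simp
      then show "birkhoff_sum \<alpha> (apply_bcontfun (t *\<^sub>R s *\<^sub>R (compose_bcontfun \<alpha> \<phi> - \<phi>))) n x
          \<le> \<bar>t * s\<bar> * (2 * norm \<phi>)"
        unfolding telescope abs_mult[symmetric] by (rule order_trans[OF abs_ge_self])
    qed
  qed
  have invariant: "blinfun_apply \<Lambda> (compose_bcontfun \<alpha> \<phi>) = blinfun_apply \<Lambda> \<phi>" for \<phi>
    using cob[of 1 \<phi>] cob[of "-1" \<phi>] by (simp add: blinfun.diff_right blinfun.minus_right)
  let ?\<Lambda> = "\<lambda>\<phi>. blinfun_apply \<Lambda> \<phi> / a"
  obtain \<nu> where \<nu>: "\<nu> \<in> invariant_probs \<alpha>" "\<And>\<phi>. ?\<Lambda> \<phi> = (\<integral>x. apply_bcontfun \<phi> x \<partial>\<nu>)"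
  proof (rule invariant_functional_is_measure[OF comp cont, of ?\<Lambda>])
    show "0 \<le> ?\<Lambda> \<phi>" if "\<And>x. 0 \<le> apply_bcontfun \<phi> x" for \<phi>
      using nonpos[of "- \<phi>"] that mass(2) by (simp add: blinfun.minus_right)
    show "?\<Lambda> (const_bcontfun 1) = 1" using mass by (simp add: total_mass_def)
  qed (use invariant in \<open>auto simp: blinfun.add_right blinfun.scaleR_right add_divide_distrib\<close>)
  have "prob_space \<nu>" "sets \<nu> = sets borel"
    using \<nu>(1) by (auto simp: invariant_probs_def regular_borel_def)
  then have "finite_measure \<nu>" "sets \<nu> = sets borel"
    by (simp_all add: prob_space_def)
  then have "\<Lambda> = a *\<^sub>R functional_of \<nu>"
    using \<nu>(2) mass(2) by (intro blinfun_eqI) (simp add: functional_of_apply blinfun.scaleR_left field_simps flip: \<nu>(2))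
  with \<nu>(1) that show thesis by blast
qed

text \<open>
  The substitution \<open>\<phi> \<mapsto> \<phi>/p\<close> in the supremum compensates the rescaling of the spectral exponent from \<open>p\<close> to \<open>1\<close>.
\<close>

lemma scaled_t_entropy:
  assumes p: "1 \<le> p" and a: "0 < a"
  shows "ereal (1 / p) * ereal a * t_entropy \<mu> \<alpha> ((1 / a) *\<^sub>R \<Lambda>)
    = (SUP \<phi>. ereal (blinfun_apply \<Lambda> \<phi> - a * spectral_exponent \<mu> \<alpha> p \<phi>))"
proof -
  let ?f = "\<lambda>\<phi>. ereal (blinfun_apply ((1 / a) *\<^sub>R \<Lambda>) \<phi>) - ereal (spectral_exponent \<mu> \<alpha> 1 \<phi>)"
  let ?g = "\<lambda>\<phi>. ereal (blinfun_apply \<Lambda> \<phi> - a * spectral_exponent \<mu> \<alpha> p \<phi>)"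
  have value_eq: "ereal (a / p) * ?f \<phi> = ?g ((1 / p) *\<^sub>R \<phi>)" for \<phi>
    using p a by (simp add: spectral_exponent_rescale[OF p] blinfun.scaleR_left blinfun.scaleR_right field_simps)
  have "ereal (1 / p) * ereal a * t_entropy \<mu> \<alpha> ((1 / a) *\<^sub>R \<Lambda>) = ereal (a / p) * (SUP \<phi>. ?f \<phi>)"
    by (simp add: t_entropy_def conjugate_dual_def conjugate_def)
  also have "\<dots> = (SUP \<phi>. ereal (a / p) * ?f \<phi>)"
    using p a by (intro Sup_ereal_mult_left') auto
  also have "\<dots> = (SUP \<phi>. ?g ((1 / p) *\<^sub>R \<phi>))" unfolding value_eq ..
  also have "\<dots> = (SUP \<phi>\<in>range (\<lambda>\<phi>. (1 / p) *\<^sub>R \<phi>). ?g \<phi>)" by (simp add: image_image)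
  also have "range (\<lambda>\<phi>::'a \<Rightarrow>\<^sub>C real. (1 / p) *\<^sub>R \<phi>) = UNIV"
    using p by (intro surjI[of _ "\<lambda>\<phi>. p *\<^sub>R \<phi>"]) simp
  finally show ?thesis .
qed

end


section \<open>The conjugate of the transformed functional\<close>

theorem theorem2p4:
  fixes P :: "'w measure" and X :: "'w \<Rightarrow> real"
    and \<mu> :: "'a::t2_space measure" and \<alpha> :: "'a \<Rightarrow> 'a" and p :: real
  assumes "prob_space P"
    and "X \<in> borel_measurable P"
    and "AE w in P. 0 \<le> X w"
    and "cramer_condition P X"
    and "compact (UNIV :: 'a set)"
    and "sets \<mu> = sets borel"
    and "\<exists>A\<in>sets \<mu>. 0 < emeasure \<mu> A \<and> emeasure \<mu> A < \<infinity>"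
    and "continuous_on UNIV \<alpha>"
    and "distr \<mu> borel \<alpha> = \<mu>"
    and "1 \<le> p"
  shows "eff_domain (conjugate_dual (lambda_X P X \<mu> \<alpha> p)) \<subseteq> M_tilde P X \<alpha> \<and>
         (\<forall>\<nu>\<in>M_tilde P X \<alpha>. total_mass \<nu> > 0 \<longrightarrow>
           conjugate_dual (lambda_X P X \<mu> \<alpha> p) \<nu> =
             ereal (1 / p) * ereal (total_mass \<nu>) *
               t_entropy \<mu> \<alpha> ((1 / total_mass \<nu>) *\<^sub>R \<nu>)
             + conjugate_real (ln_mgf_exp P X) (total_mass \<nu>)) \<and>
         (\<forall>\<nu>\<in>M_tilde P X \<alpha>. total_mass \<nu> = 0 \<longrightarrow> \<nu> = 0) \<and>
         conjugate_dual (lambda_X P X \<mu> \<alpha> p) 0 = 0"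
proof -
  interpret nonnegative_cramer P X
    using assms(1-4) by (intro nonnegative_cramer.intro nonnegative_cramer_axioms.intro)
  interpret spectral_exponent_system \<mu> \<alpha>
    using assms(6-9) by unfold_locales
  let ?F = "ln_mgf_exp P X"
  let ?r = "spectral_exponent \<mu> \<alpha> p"
  let ?S = "\<lambda>\<Lambda>. SUP \<phi>. ereal (blinfun_apply \<Lambda> \<phi> - total_mass \<Lambda> * ?r \<phi>)"
  have "lambda_X P X \<mu> \<alpha> p = (\<lambda>\<phi>. ?F (?r \<phi>))"
    by (rule ext) (auto simp: lambda_X_def eff_domain_def)
  then have split: "conjugate_dual (lambda_X P X \<mu> \<alpha> p) \<Lambda> = ?S \<Lambda> + conjugate_real ?F (total_mass \<Lambda>)" for \<Lambda>
    using conjugate_translation_equivariant[of ?r "const_bcontfun 1" ?F \<Lambda>]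
      spectral_exponent_shift[OF assms(10)] conjugate_not_minus_infinity
    by (simp add: total_mass_def)
  \<comment> \<open>The value at any single \<open>\<phi>\<close> keeps the supremum away from \<open>-\<infinity>\<close>, so a finite sum has finite summands.\<close>
  have S_ge: "ereal (blinfun_apply \<Lambda> \<phi> - total_mass \<Lambda> * ?r \<phi>) \<le> ?S \<Lambda>" for \<Lambda> \<phi>
    by (rule SUP_upper) simp
  then have S_proper: "?S \<Lambda> \<noteq> -\<infinity>" for \<Lambda>
    by (metis MInfty_neq_ereal(1) ereal_infty_less_eq(2))
  have mass: "total_mass (a *\<^sub>R functional_of \<nu>) = a" if "\<nu> \<in> invariant_probs \<alpha>" for a \<nu>
  proof -
    interpret \<nu>: prob_space \<nu> using that by (simp add: invariant_probs_def)
    have "sets \<nu> = sets borel" using that by (simp add: invariant_probs_def regular_borel_def)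
    then show ?thesis
      using \<nu>.prob_space
      by (simp add: total_mass_def functional_of_apply[OF \<nu>.finite_measure_axioms] blinfun.scaleR_left)
  qed
  have domain: "\<Lambda> \<in> M_tilde P X \<alpha>" if "\<Lambda> \<in> eff_domain (conjugate_dual (lambda_X P X \<mu> \<alpha> p))" for \<Lambda>
  proof -
    have "?S \<Lambda> + conjugate_real ?F (total_mass \<Lambda>) < \<infinity>"
      using that unfolding eff_domain_def split by simp
    then have S_fin: "?S \<Lambda> < \<infinity>" and F_fin: "conjugate_real ?F (total_mass \<Lambda>) < \<infinity>"
      using S_proper[of \<Lambda>] conjugate_not_minus_infinity[of "total_mass \<Lambda>"] by auto
    have F_dom: "total_mass \<Lambda> \<in> eff_domain (conjugate_real ?F)" using F_fin by (simp add: eff_domain_def)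
    obtain C where "?S \<Lambda> = ereal C" using S_fin S_proper[of \<Lambda>] by (cases "?S \<Lambda>") auto
    then have C: "blinfun_apply \<Lambda> \<phi> - total_mass \<Lambda> * ?r \<phi> \<le> C" for \<phi>
      using S_ge[of \<Lambda> \<phi>] by simp
    have "0 \<le> total_mass \<Lambda>"
      using F_fin conjugate_negative[of "total_mass \<Lambda>"] by (cases "total_mass \<Lambda> < 0") auto
    then consider "0 < total_mass \<Lambda>" | "total_mass \<Lambda> = 0" by linarith
    then show ?thesis
    proof cases
      case 1
      then obtain \<nu> where "\<nu> \<in> invariant_probs \<alpha>" "\<Lambda> = total_mass \<Lambda> *\<^sub>R functional_of \<nu>"
        using finite_conjugate_is_invariant[OF assms(5,10) refl 1 C] by blast
      then show ?thesis using F_dom unfolding M_tilde_def by blast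
    next
      case 2
      have le0: "blinfun_apply \<Lambda> \<phi> \<le> 0" for \<phi>
        using C[of "real n *\<^sub>R \<phi>" for n] 2
        by (intro nonpos_if_multiples_bounded[of _ C]) (simp add: blinfun.scaleR_right)
      have "blinfun_apply \<Lambda> \<phi> = 0" for \<phi>
        using le0[of \<phi>] le0[of "- \<phi>"] by (simp add: blinfun.minus_right)
      then have "\<Lambda> = 0" by (intro blinfun_eqI) simp
      moreover obtain \<nu> where "\<nu> \<in> invariant_probs \<alpha>"
        using exists_invariant_prob[OF assms(5,8)] .
      ultimately have "\<Lambda> = 0 *\<^sub>R functional_of \<nu>" "\<nu> \<in> invariant_probs \<alpha>" by simp_all
      moreover have "0 \<in> eff_domain (conjugate_real ?F)" using F_dom 2 by simp
      ultimately show ?thesis unfolding M_tilde_def by blast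
    qed
  qed
  have formula: "conjugate_dual (lambda_X P X \<mu> \<alpha> p) \<Lambda> =
      ereal (1 / p) * ereal (total_mass \<Lambda>) * t_entropy \<mu> \<alpha> ((1 / total_mass \<Lambda>) *\<^sub>R \<Lambda>)
      + conjugate_real ?F (total_mass \<Lambda>)" if "0 < total_mass \<Lambda>" for \<Lambda>
    unfolding split scaled_t_entropy[OF assms(10) that] ..
  have zero: "\<Lambda> = 0" if "\<Lambda> \<in> M_tilde P X \<alpha>" "total_mass \<Lambda> = 0" for \<Lambda>
    using that mass unfolding M_tilde_def by force
  have "conjugate_dual (lambda_X P X \<mu> \<alpha> p) 0 = 0"
    unfolding split by (simp add: total_mass_def conjugate_at_0)
  with domain formula zero show ?thesis by blast
qed

end
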